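(* Let $\mathcal C\subset\mathbb{RP}^2$ be a non-degenerate isogonal cubic with spiral center $P$ and real point at infinity $P_\infty$. For distinct $X,Y\in\mathcal C$, let $\ell_X$ be the isogonal of the line $XY$ with respect to the lines $XP,XP_\infty$, i.e. the line through $X$ such that $(XY,\ell_X)$ and $(XP,XP_\infty)$ are isogonal; similarly let $\ell_Y$ be the isogonal of $XY$ with respect to the lines $YP,YP_\infty$. Then $XY\cap\mathcal C$ (the third intersection of line $XY$ with $\mathcal C$) is the isogonal conjugate, with respect to $\mathcal C$, of $\ell_X\cap\ell_Y$.
   Context: A cubic is non-degenerate if it is irreducible. Two pairs of lines through a point $X\in\mathbb R^2$ are isogonal if they have the same pair of angle bisectors; two pairs of parallel lines (through a common real point at infinity) are isogonal if they have the same midline. For distinct $A,B,C,D\in\mathbb R^2$, the isogonal cubic of $ABCD$ is the locus of points $X\in\mathbb{RP}^2$ for which $(XA,XC)$ and $(XB,XD)$ are isogonal; identifying $\mathbb R^2$ with the complex plane, with lower-case letters for complex coordinates, its equation is $(x-b)(x-d)\,\overline{(x-a)(x-c)}=\overline{(x-b)(x-d)}\,(x-a)(x-c)$, completed projectively. An isogonal cubic is a cubic that is the isogonal cubic of some such $ABCD$. A non-degenerate isogonal cubic has exactly one real point at infinity, denoted $P_\infty$. The spiral center of $ABCD$ is the center of the spiral similarity taking $A\mapsto B$, $D\mapsto C$, i.e. the unique point $P$ with $(a-p)(c-p)=(b-p)(d-p)$. Points $X,X'$ are isogonal conjugates in $ABCD$ if $(AX,AX')$ and $(AB,AD)$ are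 isogonal and the analogous condition holds at the vertices $B,C,D$. Every $X\in\mathcal C$ has a unique isogonal conjugate in $ABCD$, lying on $\mathcal C$. The spiral center and the isogonal conjugate of a point depend only on $\mathcal C$, not on the choice of $ABCD$ having $\mathcal C$ as isogonal cubic; $P$ lies on $\mathcal C$, and $P$ and $P_\infty$ are isogonal conjugates. Conventions: for $U\in\mathcal C$, $UU$ denotes the tangent to $\mathcal C$ at $U$. For distinct $X,Y\in\mathcal C$, $XY\cap\mathcal C$ denotes the third intersection point of line $XY$ with $\mathcal C$ counted with multiplicity: if $X$ or $Y$ is singular it is that singular point; if $XY$ is tangent to $\mathcal C$ at $X$ or $Y$ it is the tangency point. *)

theory Defs
  imports "HOL-Analysis.Analysis" "HOL-Computational_Algebra.Computational_Algebra"
begin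

text \<open>
  The real projective plane is the set of one-dimensional subspaces of the three-dimensional
  real space \<open>complex \<times> real\<close>; its lines are the two-dimensional subspaces.  The vector
  \<open>(w, t)\<close> has homogeneous coordinates \<open>[Re w : Im w : t]\<close>, so the affine chart \<open>t = 1\<close> is
  the complex plane.  A point lies on a line iff it is a subset of it, and two distinct lines
  meet in the point that is their set-theoretic intersection.
\<close>

type_synonym subsp = "(complex \<times> real) set"

definition rp2 :: "subsp set" where
  "rp2 = {span {v} | v. v \<noteq> 0}"

definition fin_pt :: "complex \<Rightarrow> subsp" where
  "fin_pt x = span {(x, 1)}"

definition inf_pt :: "complex \<Rightarrow> subsp" where
  "inf_pt e = span {(e, 0)}"

definition affine_line :: "complex \<Rightarrow> complex \<Rightarrow> subsp" where
  "affine_line x d = span {(x, 1), (d, 0)}"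

definition affine_lines_through :: "subsp \<Rightarrow> subsp set" where
  "affine_lines_through X = {affine_line x d | x d. d \<noteq> 0 \<and> X \<subseteq> affine_line x d}"


text \<open>
  The line \<open>x + \<real> d\<close> bisects \<open>x + \<real> u\<close> and \<open>x + \<real> v\<close> iff the angle from the first to the
  bisector equals the angle from the bisector to the second modulo \<open>\<pi>\<close>, that is, iff the
  quotient of \<open>d / u\<close> and \<open>v / d\<close> is real.
\<close>

definition angle_bisectors :: "complex \<Rightarrow> subsp \<Rightarrow> subsp \<Rightarrow> subsp set" where
  "angle_bisectors x l l' =
     {affine_line x d | d u v. d \<noteq> 0 \<and> u \<noteq> 0 \<and> v \<noteq> 0 \<and>
        l = affine_line x u \<and> l' = affine_line x v \<and> (d / u) / (v / d) \<in> \<real>}"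

text \<open>For two lines parallel to \<open>e\<close> this is a singleton.\<close>

definition midlines :: "complex \<Rightarrow> subsp \<Rightarrow> subsp \<Rightarrow> subsp set" where
  "midlines e l l' =
     {affine_line ((p + q) / 2) e | p q. l = affine_line p e \<and> l' = affine_line q e}"

text \<open>\<open>isogonal X l1 l2 m1 m2\<close>: the pairs \<open>(l1, l2)\<close> and \<open>(m1, m2)\<close> of lines through \<open>X\<close> are isogonal.\<close>

definition isogonal :: "subsp \<Rightarrow> subsp \<Rightarrow> subsp \<Rightarrow> subsp \<Rightarrow> subsp \<Rightarrow> bool" where
  "isogonal X l1 l2 m1 m2 \<longleftrightarrow>
     {l1, l2, m1, m2} \<subseteq> affine_lines_through X \<and>
     ((\<exists>x. X = fin_pt x \<and> angle_bisectors x l1 l2 = angle_bisectors x m1 m2) \<or>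
      (\<exists>e. e \<noteq> 0 \<and> X = inf_pt e \<and> midlines e l1 l2 = midlines e m1 m2))"

definition isogonal_line :: "subsp \<Rightarrow> subsp \<Rightarrow> subsp \<Rightarrow> subsp \<Rightarrow> subsp" where
  "isogonal_line X l m1 m2 = (THE l'. isogonal X l l' m1 m2)"


text \<open>
  A projective curve is given by a form in three variables, an element of \<open>\<real>[x, y, z]\<close>.
\<close>

type_synonym form = "real poly poly poly"

definition ev :: "form \<Rightarrow> complex \<times> real \<Rightarrow> real" where
  "ev F v = poly (poly (poly F [:[:Re (fst v):]:]) [:Im (fst v):]) (snd v)"

definition homogeneous :: "nat \<Rightarrow> form \<Rightarrow> bool" where
  "homogeneous n F \<longleftrightarrow> (\<forall>k v. ev F (k *\<^sub>R v) = k ^ n * ev F v)"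

definition curve :: "form \<Rightarrow> subsp set" where
  "curve F = {X \<in> rp2. \<forall>v\<in>X. ev F v = 0}"

text \<open>The kernel of the gradient; it is a line exactly at the smooth points of the curve.\<close>

definition tangent :: "form \<Rightarrow> subsp \<Rightarrow> subsp" where
  "tangent F U =
     {w. \<forall>v\<in>U. ((\<lambda>t. ev F (v + t *\<^sub>R w)) has_real_derivative 0) (at 0)}"

definition line_join :: "form \<Rightarrow> subsp \<Rightarrow> subsp \<Rightarrow> subsp" where
  "line_join F U V = (if U = V then tangent F U else span (U \<union> V))"

text \<open>
  The cubic restricted to the line \<open>XY\<close>, in the coordinates \<open>(s : t)\<close> of the point
  \<open>s x + t y\<close>, is a binary cubic form with the roots \<open>(1 : 0)\<close> and \<open>(0 : 1)\<close>, which are \<open>X\<close> and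
  \<open>Y\<close>.  The third intersection, with multiplicities counted, is its remaining root \<open>(\<alpha> : \<beta>)\<close>.
\<close>

definition third_intersection :: "form \<Rightarrow> subsp \<Rightarrow> subsp \<Rightarrow> subsp" where
  "third_intersection F X Y =
     (THE Q. \<exists>x y \<alpha> \<beta>. X = span {x} \<and> Y = span {y} \<and> (\<alpha>, \<beta>) \<noteq> (0, 0) \<and>
        Q = span {\<alpha> *\<^sub>R x + \<beta> *\<^sub>R y} \<and>
        (\<forall>s t. ev F (s *\<^sub>R x + t *\<^sub>R y) = s * t * (\<beta> * s - \<alpha> * t)))"


text \<open>
  The projective completion is the cubic form whose dehomogenization is the affine equation.
  Forms differing by a nonzero constant define the same cubic; a factor making the equation
  real is always imaginary.
\<close>

definition isogonal_cubic_of ::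
    "form \<Rightarrow> complex \<Rightarrow> complex \<Rightarrow> complex \<Rightarrow> complex \<Rightarrow> bool" where
  "isogonal_cubic_of F a b c d \<longleftrightarrow> distinct [a, b, c, d] \<and> homogeneous 3 F \<and>
     (\<exists>\<kappa>. \<kappa> \<noteq> 0 \<and> (\<forall>x. complex_of_real (ev F (x, 1)) =
        \<kappa> * ((x - b) * (x - d) * cnj ((x - a) * (x - c))
           - cnj ((x - b) * (x - d)) * ((x - a) * (x - c)))))"

definition isogonal_cubic :: "form \<Rightarrow> bool" where
  "isogonal_cubic F \<longleftrightarrow> (\<exists>a b c d. isogonal_cubic_of F a b c d)"

definition spiral_center :: "form \<Rightarrow> subsp \<Rightarrow> bool" where
  "spiral_center F P \<longleftrightarrow>
     (\<exists>a b c d p. isogonal_cubic_of F a b c d \<and>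
        (a - p) * (c - p) = (b - p) * (d - p) \<and> P = fin_pt p)"

text \<open>The form \<open>F\<close> enters only through the convention that \<open>AX\<close> is the tangent if \<open>X = A\<close>.\<close>

definition isogonal_conjugates_in ::
    "form \<Rightarrow> complex \<Rightarrow> complex \<Rightarrow> complex \<Rightarrow> complex \<Rightarrow> subsp \<Rightarrow> subsp \<Rightarrow> bool" where
  "isogonal_conjugates_in F a b c d X X' \<longleftrightarrow>
     (let A = fin_pt a; B = fin_pt b; C = fin_pt c; D = fin_pt d; L = line_join F in
        isogonal A (L A X) (L A X') (L A B) (L A D) \<and>
        isogonal B (L B X) (L B X') (L B A) (L B C) \<and>
        isogonal C (L C X) (L C X') (L C B) (L C D) \<and>
        isogonal D (L D X) (L D X') (L D C) (L D A))"

text \<open>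
  Conjugacy in \<open>ABCD\<close> does not depend on the choice of \<open>ABCD\<close> with the isogonal cubic \<open>F\<close>;
  conjugacy with respect to \<open>F\<close> is required for every such choice.
\<close>

definition isogonal_conjugates :: "form \<Rightarrow> subsp \<Rightarrow> subsp \<Rightarrow> bool" where
  "isogonal_conjugates F X X' \<longleftrightarrow> X \<in> curve F \<and> X' \<in> curve F \<and>
     (\<forall>a b c d. isogonal_cubic_of F a b c d \<longrightarrow> isogonal_conjugates_in F a b c d X X')"

end

theory Submission
  imports Defs
begin

text \<open>
  Let \<open>p\<close> be the spiral center and use the coordinate \<open>x\<close> centered at \<open>p\<close>.  Writing \<open>m = ac = bd\<close> and
  \<open>w\<close> for a real multiple of \<open>b + d - a - c\<close>, the affine equation of the cubic becomes
  \<open>Im (cnj w (x + m / x)) = k\<close> for some real \<open>k\<close>.  Its real point at infinity has the direction \<open>w\<close>, and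
  isogonal conjugation is \<open>x \<mapsto> m / x\<close>, exchanging \<open>P\<close> and \<open>P\<^sub>\<infinity>\<close>.  From
  \<open>(z - u) (m / z - u) = u ((u + m / u) - (z + m / z))\<close> it follows that for \<open>U\<close>, \<open>Z\<close> on the cubic and
  \<open>Z'\<close> conjugate to \<open>Z\<close> the pairs \<open>(UZ, UZ')\<close> and \<open>(UP, UP\<^sub>\<infinity>)\<close> are isogonal.

  If \<open>Z\<close> is the third intersection of \<open>XY\<close> with the cubic, then \<open>XZ = XY\<close>, so \<open>\<ell>\<^sub>X = XZ'\<close>, and likewise
  \<open>\<ell>\<^sub>Y = YZ'\<close>.  Hence \<open>Z'\<close> is the intersection unless \<open>\<ell>\<^sub>X = \<ell>\<^sub>Y\<close>; then both equal \<open>XY\<close>, which forces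
  \<open>k = 0\<close> and \<open>m / w\<^sup>2\<close> real, and the cubic splits into a line and a conic.
\<close>

section \<open>Points, lines and isogonality\<close>

lemma mem_fin_pt: "(z, t) \<in> fin_pt x \<longleftrightarrow> z = of_real t * x"
  by (auto simp: fin_pt_def span_singleton scaleR_conv_of_real image_iff)

lemma mem_inf_pt: "(z, t) \<in> inf_pt e \<longleftrightarrow> t = 0 \<and> (\<exists>s. z = of_real s * e)"
  by (auto simp: inf_pt_def span_singleton scaleR_conv_of_real image_iff)

lemma div_Reals_iff: "d \<noteq> 0 \<Longrightarrow> z / d \<in> \<real> \<longleftrightarrow> (\<exists>s. z = complex_of_real s * d)"
  by (auto simp: Reals_def field_simps)

text \<open>Dividing by the direction turns incidence into reality of a quotient; all later
  incidence and parallelism conditions are computed in this form.\<close>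

lemma mem_affine_line:
  assumes "d \<noteq> 0"
  shows "(z, t) \<in> affine_line x d \<longleftrightarrow> (z - of_real t * x) / d \<in> \<real>"
  unfolding div_Reals_iff[OF assms] affine_line_def
  by (auto simp: span_insert span_singleton scaleR_conv_of_real image_iff algebra_simps)

lemma fin_pt_subset_iff: "subspace S \<Longrightarrow> fin_pt x \<subseteq> S \<longleftrightarrow> (x, 1) \<in> S"
  unfolding fin_pt_def by (metis span_minimal span_base singletonI singletonD subsetD subsetI)

lemma inf_pt_subset_iff: "subspace S \<Longrightarrow> inf_pt e \<subseteq> S \<longleftrightarrow> (e, 0) \<in> S"
  unfolding inf_pt_def by (metis span_minimal span_base singletonI singletonD subsetD subsetI)

lemma subspace_affine_line [simp]: "subspace (affine_line x d)"
  by (simp add: affine_line_def)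

lemma fin_pt_subset_affine_line:
  "d \<noteq> 0 \<Longrightarrow> fin_pt x \<subseteq> affine_line y d \<longleftrightarrow> (x - y) / d \<in> \<real>"
  by (simp add: fin_pt_subset_iff mem_affine_line)

lemma inf_pt_subset_affine_line:
  "d \<noteq> 0 \<Longrightarrow> inf_pt e \<subseteq> affine_line y d \<longleftrightarrow> e / d \<in> \<real>"
  by (simp add: inf_pt_subset_iff mem_affine_line)

lemma Reals_divide_swap: "d / e \<in> \<real> \<Longrightarrow> e / d \<in> (\<real> :: complex set)"
  using Reals_inverse[of "d / e"] by (simp add: inverse_eq_divide)

lemma Reals_divide_trans:
  "\<lbrakk>a / b \<in> \<real>; b / c \<in> \<real>; b \<noteq> 0\<rbrakk> \<Longrightarrow> a / c \<in> (\<real> :: complex set)"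
  using Reals_mult[of "a / b" "b / c"] by simp

lemma affine_line_subset:
  assumes "d \<noteq> 0" "e \<noteq> 0" "d / e \<in> \<real>" "(x - y) / e \<in> \<real>"
  shows "affine_line x d \<subseteq> affine_line y e"
  unfolding affine_line_def[of x d]
  using assms by (intro span_minimal) (auto simp: mem_affine_line)

lemma affine_line_eq_iff:
  assumes "d \<noteq> 0" "e \<noteq> 0"
  shows "affine_line x d = affine_line y e \<longleftrightarrow> d / e \<in> \<real> \<and> (x - y) / e \<in> \<real>"
proof
  assume eq: "affine_line x d = affine_line y e"
  have "(x, 1) \<in> affine_line x d" "(d, 0) \<in> affine_line x d"
    using assms by (simp_all add: mem_affine_line)
  then show "d / e \<in> \<real> \<and> (x - y) / e \<in> \<real>"
    using assms by (simp add: eq mem_affine_line)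
next
  assume *: "d / e \<in> \<real> \<and> (x - y) / e \<in> \<real>"
  then have "e / d \<in> \<real>" by (simp add: Reals_divide_swap)
  moreover have "(y - x) / e \<in> \<real>"
    using * Reals_minus[of "(x - y) / e"] by (metis minus_diff_eq minus_divide_left)
  ultimately have "(y - x) / d \<in> \<real>"
    using assms Reals_divide_trans by blast
  with * \<open>e / d \<in> \<real>\<close> assms show "affine_line x d = affine_line y e"
    by (intro equalityI affine_line_subset) auto
qed

lemma fin_pt_eq_iff [simp]: "fin_pt x = fin_pt y \<longleftrightarrow> x = y"
proof
  assume "fin_pt x = fin_pt y"
  then have "(x, 1) \<in> fin_pt y" using mem_fin_pt[of x 1 x] by simp
  then show "x = y" by (simp add: mem_fin_pt)
qed simp

lemma fin_pt_neq_inf_pt [simp]: "fin_pt x \<noteq> inf_pt e" "inf_pt e \<noteq> fin_pt x"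
proof -
  have "(x, 1) \<in> fin_pt x" "(x, 1) \<notin> inf_pt e" by (simp_all add: mem_fin_pt mem_inf_pt)
  then show "fin_pt x \<noteq> inf_pt e" "inf_pt e \<noteq> fin_pt x" by auto
qed

lemma inf_pt_eq_iff:
  assumes "d \<noteq> 0" "e \<noteq> 0"
  shows "inf_pt d = inf_pt e \<longleftrightarrow> d / e \<in> \<real>"
proof
  assume "inf_pt d = inf_pt e"
  moreover have "(d, 0) \<in> inf_pt d" by (auto simp: mem_inf_pt intro: exI[of _ 1])
  ultimately show "d / e \<in> \<real>" by (simp add: mem_inf_pt div_Reals_iff assms)
next
  have *: "inf_pt u \<subseteq> inf_pt v" if "u / v \<in> \<real>" "v \<noteq> 0" for u v
    using that inf_pt_subset_iff[of "inf_pt v" u]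
    by (auto simp: inf_pt_def mem_inf_pt[unfolded inf_pt_def] div_Reals_iff)
  assume "d / e \<in> \<real>"
  then show "inf_pt d = inf_pt e"
    using assms by (intro equalityI *) (auto intro: Reals_divide_swap)
qed

lemma span_Un_span: "span (span A \<union> span B) = span (A \<union> B)"
  by (intro subset_antisym span_minimal) (auto intro: span_mono[THEN subsetD] span_base)

lemma span_pair_eq_affine_line: "span {(x, 1), (y, 1)} = affine_line x (y - x)"
proof -
  let ?S = "span {(x, 1), (y, 1 :: real)}"
  have "(x, 1) \<in> ?S" "(y, 1) \<in> ?S" by (auto intro: span_base)
  moreover from this have "(y - x, 0) \<in> ?S" using span_diff[of "(y, 1)" _ "(x, 1)"] by simp
  moreover have "(x, 1) \<in> affine_line x (y - x)" "(y - x, 0) \<in> affine_line x (y - x)"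
    by (auto simp: affine_line_def intro: span_base)
  moreover from this have "(y, 1) \<in> affine_line x (y - x)"
    using subspace_add[OF subspace_affine_line, of "(x, 1)" x "y - x" "(y - x, 0)"] by simp
  ultimately show ?thesis
    unfolding affine_line_def by (intro subset_antisym span_minimal) auto
qed

lemma line_join_fin_fin: "x \<noteq> y \<Longrightarrow> line_join F (fin_pt x) (fin_pt y) = affine_line x (y - x)"
  using span_pair_eq_affine_line[of x y]
  by (simp add: line_join_def fin_pt_def[of x] fin_pt_def[of y] span_Un_span insert_commute
      flip: fin_pt_eq_iff)

lemma line_join_fin_inf: "line_join F (fin_pt x) (inf_pt e) = affine_line x e"
  by (simp add: line_join_def, simp add: fin_pt_def inf_pt_def affine_line_def span_Un_span insert_commute)

lemma line_join_inf_fin: "line_join F (inf_pt e) (fin_pt x) = affine_line x e"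
  by (simp add: line_join_def, simp add: fin_pt_def inf_pt_def affine_line_def span_Un_span insert_commute)

lemma line_join_commute: "X \<noteq> Y \<Longrightarrow> line_join F X Y = line_join F Y X"
  by (simp add: line_join_def Un_commute)

section \<open>Isogonality in terms of directions and offsets\<close>

lemma affine_lines_through_fin_iff:
  "l \<in> affine_lines_through (fin_pt x) \<longleftrightarrow> (\<exists>d. d \<noteq> 0 \<and> l = affine_line x d)"
proof
  assume "l \<in> affine_lines_through (fin_pt x)"
  then obtain y d where *: "d \<noteq> 0" "l = affine_line y d" "(x - y) / d \<in> \<real>"
    by (auto simp: affine_lines_through_def fin_pt_subset_affine_line)
  then have "l = affine_line x d" using affine_line_eq_iff[of d d x y] by simp
  with * show "\<exists>d. d \<noteq> 0 \<and> l = affine_line x d" by blast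
next
  assume "\<exists>d. d \<noteq> 0 \<and> l = affine_line x d"
  moreover have "fin_pt x \<subseteq> affine_line x d" if "d \<noteq> 0" for d
    using that by (simp add: fin_pt_subset_affine_line)
  ultimately show "l \<in> affine_lines_through (fin_pt x)"
    unfolding affine_lines_through_def by blast
qed

lemma affine_lines_through_inf_iff:
  assumes "e \<noteq> 0"
  shows "l \<in> affine_lines_through (inf_pt e) \<longleftrightarrow> (\<exists>p. l = affine_line p e)"
proof
  assume "l \<in> affine_lines_through (inf_pt e)"
  then obtain y d where *: "d \<noteq> 0" "l = affine_line y d" "e / d \<in> \<real>"
    by (auto simp: affine_lines_through_def inf_pt_subset_affine_line)
  then have "affine_line y e = l" using assms by (simp add: affine_line_eq_iff)
  then show "\<exists>p. l = affine_line p e" by blast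
next
  assume "\<exists>p. l = affine_line p e"
  moreover have "inf_pt e \<subseteq> affine_line p e" for p
    using assms by (simp add: inf_pt_subset_affine_line)
  ultimately show "l \<in> affine_lines_through (inf_pt e)"
    unfolding affine_lines_through_def using assms by blast
qed

text \<open>The definition ranges over all direction vectors of the two lines. Replacing them by
  real multiples changes \<open>d^2 / (u * v)\<close> by a real factor only, so fixed
  representatives suffice.\<close>

lemma angle_bisectors_affine_line:
  assumes "u \<noteq> 0" "v \<noteq> 0"
  shows "angle_bisectors x (affine_line x u) (affine_line x v) =
    {affine_line x d | d. d \<noteq> 0 \<and> d\<^sup>2 / (u * v) \<in> \<real>}"
proof -
  have "d\<^sup>2 / (u * v) \<in> \<real>" if "u' \<noteq> 0" "v' \<noteq> 0" "affine_line x u = affine_line x u'"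
     "affine_line x v = affine_line x v'" "(d / u') / (v' / d) \<in> \<real>" for d u' v'
  proof -
    have "u' / u \<in> \<real>" "v' / v \<in> \<real>" using that assms by (auto simp: affine_line_eq_iff Reals_divide_swap)
    then have "(u' / u) * (v' / v) * ((d / u') / (v' / d)) \<in> \<real>" using that by (intro Reals_mult)
    then show ?thesis using that by (simp add: field_simps power2_eq_square)
  qed
  then have "angle_bisectors x (affine_line x u) (affine_line x v)
      \<subseteq> {affine_line x d | d. d \<noteq> 0 \<and> d\<^sup>2 / (u * v) \<in> \<real>}"
    unfolding angle_bisectors_def by blast
  moreover have "(d / u) / (v / d) = d\<^sup>2 / (u * v)" for d by (simp add: power2_eq_square)
  then have "{affine_line x d | d. d \<noteq> 0 \<and> d\<^sup>2 / (u * v) \<in> \<real>}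
      \<subseteq> angle_bisectors x (affine_line x u) (affine_line x v)"
    unfolding angle_bisectors_def using assms
    by (intro subsetI, elim CollectE exE) (rule CollectI, metis)
  ultimately show ?thesis by (rule subset_antisym)
qed

text \<open>The pair of bisectors determines the product of the two directions up to a real factor,
  and is determined by it.\<close>

lemma isogonal_fin_iff:
  assumes "u1 \<noteq> 0" "u2 \<noteq> 0" "v1 \<noteq> 0" "v2 \<noteq> 0"
  shows "isogonal (fin_pt x) (affine_line x u1) (affine_line x u2) (affine_line x v1) (affine_line x v2)
    \<longleftrightarrow> (u1 * u2) / (v1 * v2) \<in> \<real>"
proof -
  have "{affine_line x d | d. d \<noteq> 0 \<and> d\<^sup>2 / U \<in> \<real>} = {affine_line x d | d. d \<noteq> 0 \<and> d\<^sup>2 / V \<in> \<real>}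
     \<longleftrightarrow> U / V \<in> \<real>" (is "?A U = ?A V \<longleftrightarrow> _") if UV: "U \<noteq> 0" "V \<noteq> 0" for U V
  proof
    assume eq: "?A U = ?A V"
    \<comment> \<open>The direction \<open>csqrt U\<close> is that of a bisector; its square
      recovers the product \<open>U\<close>.\<close>
    have "affine_line x (csqrt U) \<in> ?A U" using UV by (auto intro!: exI[of _ "csqrt U"])
    then obtain d where d: "affine_line x (csqrt U) = affine_line x d" "d \<noteq> 0" "d\<^sup>2 / V \<in> \<real>"
      unfolding eq by auto
    then have "csqrt U / d \<in> \<real>" using UV by (simp add: affine_line_eq_iff)
    then have "(csqrt U / d)\<^sup>2 * (d\<^sup>2 / V) \<in> \<real>" using d by (intro Reals_mult Reals_power)
    then show "U / V \<in> \<real>" using d by (simp add: power_divide)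
  next
    assume "U / V \<in> \<real>"
    then have "d\<^sup>2 / U \<in> \<real> \<longleftrightarrow> d\<^sup>2 / V \<in> \<real>" for d
      using UV by (meson Reals_divide_swap Reals_divide_trans)
    then show "?A U = ?A V" by simp
  qed
  from this[of "u1 * u2" "v1 * v2"] show ?thesis
    unfolding isogonal_def using assms
    by (auto simp: affine_lines_through_fin_iff angle_bisectors_affine_line)
qed

lemma midlines_affine_line:
  assumes "e \<noteq> 0"
  shows "midlines e (affine_line p e) (affine_line q e) = {affine_line ((p + q) / 2) e}"
proof -
  have "affine_line ((p' + q') / 2) e = affine_line ((p + q) / 2) e"
    if "affine_line p e = affine_line p' e" "affine_line q e = affine_line q' e" for p' q'
  proof -
    have "(p - p') / e \<in> \<real>" "(q - q') / e \<in> \<real>" using that assms by (auto simp: affine_line_eq_iff)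
    then have "((p - p') / e + (q - q') / e) / 2 \<in> \<real>"
      by (intro Reals_divide[OF Reals_add]) auto
    then have "((p + q) / 2 - (p' + q') / 2) / e \<in> \<real>"
      by (simp add: add_divide_distrib diff_divide_distrib algebra_simps)
    then have "affine_line ((p + q) / 2) e = affine_line ((p' + q') / 2) e"
      using assms by (simp add: affine_line_eq_iff)
    then show ?thesis ..
  qed
  then show ?thesis unfolding midlines_def by blast
qed

lemma isogonal_inf_iff:
  assumes "e \<noteq> 0"
  shows "isogonal (inf_pt e) (affine_line p1 e) (affine_line p2 e) (affine_line q1 e) (affine_line q2 e)
    \<longleftrightarrow> ((p1 + p2) - (q1 + q2)) / e \<in> \<real>"
proof -
  have mid: "midlines e' (affine_line p1 e) (affine_line p2 e) = midlines e' (affine_line q1 e) (affine_line q2 e)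
    \<longleftrightarrow> ((p1 + p2) - (q1 + q2)) / e \<in> \<real>" if "e' \<noteq> 0" "e / e' \<in> \<real>" for e'
  proof -
    have al: "affine_line p e = affine_line p e'" for p
      using that assms by (simp add: affine_line_eq_iff)
    have h: "((p1 + p2) / 2 - (q1 + q2) / 2) / e = ((p1 + p2) - (q1 + q2)) / e / 2"
      by (simp flip: diff_divide_distrib)
    have r: "z / 2 \<in> \<real> \<longleftrightarrow> z \<in> \<real>" for z :: complex
      using Reals_mult[of 2 "z / 2"] by (auto intro: Reals_divide)
    have "((p1 + p2) - (q1 + q2)) / e \<in> \<real> \<longleftrightarrow> affine_line ((p1 + p2) / 2) e = affine_line ((q1 + q2) / 2) e"
      unfolding affine_line_eq_iff[OF assms assms] h r using assms by simp
    then show ?thesis unfolding al using that by (simp add: midlines_affine_line)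
  qed
  show ?thesis
    unfolding isogonal_def using mid[of e] mid assms
    by (auto simp: affine_lines_through_inf_iff inf_pt_eq_iff)
qed

text \<open>Two instances of the criterion are divided at a finite point and subtracted at infinity;
  only the two candidate lines remain. This makes the definite description in
  \<open>isogonal_line\<close> meaningful.\<close>

lemma isogonal_unique:
  assumes "isogonal X l l1 m1 m2" "isogonal X l l2 m1 m2"
  shows "l1 = l2"
proof -
  consider x where "X = fin_pt x" | e where "e \<noteq> 0" "X = inf_pt e"
    using assms(1) unfolding isogonal_def by blast
  then show ?thesis
  proof cases
    case 1
    then obtain u u1 u2 v1 v2 where u: "u \<noteq> 0" "u1 \<noteq> 0" "u2 \<noteq> 0" "v1 \<noteq> 0" "v2 \<noteq> 0"
      "l = affine_line x u" "l1 = affine_line x u1" "l2 = affine_line x u2"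
      "m1 = affine_line x v1" "m2 = affine_line x v2"
      using assms unfolding isogonal_def by (auto simp: affine_lines_through_fin_iff)
    then have "(u * u1) / (v1 * v2) \<in> \<real>" "(v1 * v2) / (u * u2) \<in> \<real>"
      using assms 1 by (auto simp: isogonal_fin_iff intro: Reals_divide_swap)
    then have "(u * u1) / (u * u2) \<in> \<real>" using u by (elim Reals_divide_trans) auto
    then show ?thesis using u by (simp add: affine_line_eq_iff)
  next
    case 2
    then obtain p p1 p2 q1 q2 where p: "l = affine_line p e" "l1 = affine_line p1 e" "l2 = affine_line p2 e"
      "m1 = affine_line q1 e" "m2 = affine_line q2 e"
      using assms unfolding isogonal_def by (auto simp: affine_lines_through_inf_iff)
    then have "(p + p1 - (q1 + q2)) / e \<in> \<real>" "(p + p2 - (q1 + q2)) / e \<in> \<real>"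
      using assms 2 by (auto simp: isogonal_inf_iff)
    then have "(p + p1 - (q1 + q2)) / e - (p + p2 - (q1 + q2)) / e \<in> \<real>" by (rule Reals_diff)
    then have "(p1 - p2) / e \<in> \<real>" by (simp add: diff_divide_distrib add_divide_distrib)
    then show ?thesis using p 2 by (simp add: affine_line_eq_iff)
  qed
qed

lemma isogonal_line_eqI: "isogonal X l l' m1 m2 \<Longrightarrow> isogonal_line X l m1 m2 = l'"
  unfolding isogonal_line_def by (rule the_equality) (iprover intro: isogonal_unique)+

section \<open>Joins and intersections by dimension count\<close>

lemma dim_rp2: "X \<in> rp2 \<Longrightarrow> dim X = 1"
  by (auto simp: rp2_def dim_singleton)

lemma subspace_rp2: "X \<in> rp2 \<Longrightarrow> subspace X"
  by (auto simp: rp2_def)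

lemma rp2_subset_imp_eq: "\<lbrakk>X \<in> rp2; subspace S; X \<subseteq> S; dim S \<le> 1\<rbrakk> \<Longrightarrow> X = S"
  by (rule subspace_dim_equal) (auto simp: dim_rp2 subspace_rp2)

lemma dim_affine_line: "dim (affine_line x d) \<le> 2"
proof -
  have "dim (affine_line x d) \<le> card {(x, 1 :: real), (d, 0)}"
    unfolding affine_line_def dim_span by (rule dim_le_card') simp
  also have "\<dots> \<le> 2" by (simp add: card_insert_if)
  finally show ?thesis .
qed

lemma span_Un_eq_line:
  assumes "X \<in> rp2" "Y \<in> rp2" "X \<noteq> Y" "X \<subseteq> l" "Y \<subseteq> l" "subspace l" "dim l \<le> 2"
  shows "span (X \<union> Y) = l"
proof (rule subspace_dim_equal)
  show "span (X \<union> Y) \<subseteq> l" using assms by (intro span_minimal) auto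
  show "dim l \<le> dim (span (X \<union> Y))"
  proof (rule ccontr)
    assume "\<not> dim l \<le> dim (span (X \<union> Y))"
    then have "dim (span (X \<union> Y)) \<le> 1" using assms(7) by linarith
    moreover have "X \<subseteq> span (X \<union> Y)" "Y \<subseteq> span (X \<union> Y)" using span_superset by blast+
    ultimately have "X = span (X \<union> Y)" "Y = span (X \<union> Y)"
      using rp2_subset_imp_eq[OF assms(1) subspace_span] rp2_subset_imp_eq[OF assms(2) subspace_span] by blast+
    with assms(3) show False by simp
  qed
qed (auto simp: assms)

lemma lines_Int_eq_point:
  assumes "subspace l" "subspace l'" "dim l \<le> 2" "dim l' \<le> 2" "l \<noteq> l'" "Z \<in> rp2" "Z \<subseteq> l" "Z \<subseteq> l'"
  shows "l \<inter> l' = Z"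
proof -
  have "dim (l \<inter> l') \<le> 1"
  proof (rule ccontr)
    assume "\<not> dim (l \<inter> l') \<le> 1"
    then have "l \<inter> l' = l" "l \<inter> l' = l'"
      using assms by (intro subspace_dim_equal subspace_inter; simp)+
    with assms(5) show False by simp
  qed
  then show ?thesis
    using assms rp2_subset_imp_eq[of Z "l \<inter> l'"] by (simp add: subspace_inter)
qed

lemma affine_lines_throughD:
  assumes "l \<in> affine_lines_through X"
  shows "X \<subseteq> l" "subspace l" "dim l \<le> 2"
  using assms by (auto simp: affine_lines_through_def dim_affine_line)

lemma isogonalD:
  assumes "isogonal X l1 l2 m1 m2"
  shows "l1 \<in> affine_lines_through X" "l2 \<in> affine_lines_through X"
  using assms by (auto simp: isogonal_def)

lemma divide_in_Reals_iff: "w \<noteq> 0 \<Longrightarrow> z / w \<in> \<real> \<longleftrightarrow> Im (cnj w * z) = 0"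
  by (simp add: complex_is_Real_iff Im_complex_div_eq_0 mult.commute)

lemma Im_of_real_mult: "Im (of_real r * z) = r * Im z"
  by simp

lemma rp2_cases:
  assumes "X \<in> rp2"
  obtains x where "X = fin_pt x" | e where "e \<noteq> 0" "X = inf_pt e"
proof -
  obtain x t where *: "(x, t) \<noteq> 0" "X = span {(x, t)}" using assms by (auto simp: rp2_def)
  show thesis
  proof (cases "t = 0")
    case True
    with * that(2)[of x] show ?thesis by (auto simp: inf_pt_def zero_prod_def)
  next
    case False
    have "(x, t) = t *\<^sub>R (x / of_real t, 1)" "(x / of_real t, 1) = (1 / t) *\<^sub>R (x, t)"
      using False by (simp_all add: scaleR_conv_of_real)
    then have "(x, t) \<in> span {(x / of_real t, 1)}" "(x / of_real t, 1) \<in> span {(x, t)}"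
      by (metis span_scale span_base singletonI)+
    then have "X = fin_pt (x / of_real t)"
      unfolding * fin_pt_def by (intro subset_antisym span_minimal) auto
    then show ?thesis by (rule that(1))
  qed
qed

section \<open>Normal form of an isogonal cubic\<close>

lemma ev_add: "ev (G + H) v = ev G v + ev H v"
  and ev_diff: "ev (G - H) v = ev G v - ev H v"
  and ev_mult: "ev (G * H) v = ev G v * ev H v"
  and ev_1: "ev 1 v = 1"
  and ev_const: "ev [:[:[:c:]:]:] v = c"
  and ev_X: "ev [:0, 1:] v = Re (fst v)"
  and ev_Y: "ev [:[:0, 1:]:] v = Im (fst v)"
  and ev_Z: "ev [:[:[:0, 1:]:]:] v = snd v"
  by (simp_all add: ev_def)

lemma poly_eq_0_of_infinite:
  fixes p :: "'a :: idom poly"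
  assumes "infinite (range f)" "\<And>x. poly p (f x) = 0"
  shows "p = 0"
proof (rule ccontr)
  assume "p \<noteq> 0"
  then have "finite {x. poly p x = 0}" by (rule poly_roots_finite)
  moreover have "range f \<subseteq> {x. poly p x = 0}" using assms(2) by auto
  ultimately show False using assms(1) finite_subset by blast
qed

text \<open>The variables are removed one at a time, from the innermost to the outermost: at each
  level the polynomial has infinitely many constants as roots.\<close>

lemma ev_eqI:
  assumes "\<And>v. ev G v = ev H v"
  shows "G = H"
proof -
  have inj: "infinite (range (\<lambda>x :: real. x))" "infinite (range (\<lambda>x :: real. [:x:]))"
    "infinite (range (\<lambda>x :: real. [:[:x:]:]))"
    by (auto simp: finite_image_iff inj_on_def infinite_UNIV_char_0 dest: finite_imageD)
  have "ev (G - H) v = 0" for v using assms by (simp add: ev_diff)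
  from this[of "(Complex _ _, _)"]
  have "poly (poly (poly (G - H) [:[:x:]:]) [:y:]) z = 0" for x y z by (simp add: ev_def)
  then have "poly (poly (G - H) [:[:x:]:]) [:y:] = 0" for x y
    by (intro poly_eq_0_of_infinite[OF inj(1)]) auto
  then have "poly (G - H) [:[:x:]:] = 0" for x
    by (intro poly_eq_0_of_infinite[OF inj(2)]) auto
  then have "G - H = 0"
    by (intro poly_eq_0_of_infinite[OF inj(3)]) auto
  then show ?thesis by simp
qed

text \<open>The zeros \<open>v0\<close> and \<open>v1\<close> ensure that neither factor is a unit,
  since a unit has no zero.\<close>

lemma not_irreducible_of_ev_eq_mult:
  assumes "\<And>v. ev F v = ev G v * ev H v" "ev G v0 = 0" "ev H v1 = 0"
  shows "\<not> irreducible F"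
proof
  assume "irreducible F"
  moreover have "F = G * H" by (rule ev_eqI) (simp add: assms ev_mult)
  ultimately have "G dvd 1 \<or> H dvd 1" by (auto dest: irreducibleD)
  moreover have "\<not> K dvd 1" if "ev K v = 0" for K v
    using that ev_1[of v] ev_mult[of K _ v] by (metis dvdE mult_zero_left zero_neq_one)
  ultimately show False using assms(2,3) by blast
qed

text \<open>
  For \<open>x \<noteq> 0\<close> this is \<open>\<bar>x\<bar>\<^sup>2 (Im (cnj w (x + t\<^sup>2 m / x)) - t k)\<close>.
\<close>

definition iso_form :: "complex \<Rightarrow> complex \<Rightarrow> real \<Rightarrow> complex \<Rightarrow> real \<Rightarrow> real" where
  "iso_form w m k x t =
     Im (cnj w * x) * (norm x)\<^sup>2 - t * k * (norm x)\<^sup>2 + t\<^sup>2 * Im (cnj w * m * cnj x)"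

text \<open>Here \<open>q\<close>, \<open>n\<close> and \<open>s\<close>, \<open>l\<close> stand for
  sum and product of the two pairs of opposite vertices. The terms are sorted by degree in
  \<open>x\<close> for a comparison of coefficients.\<close>

lemma isogonal_equation_expand:
  "Im ((x\<^sup>2 - q * x + n) * cnj (x\<^sup>2 - s * x + l)) =
    Im ((cnj q - cnj s) * x) * (norm x)\<^sup>2 + Im (q * cnj s) * (norm x)\<^sup>2
    + Im ((cnj l - cnj n) * x\<^sup>2) + Im ((cnj n * s - q * cnj l) * x) + Im (n * cnj l)"
  by (simp add: cmod_power2) (simp add: algebra_simps power2_eq_square)

lemma cubic_coefficients_eq_0:
  assumes "\<And>x. Im (U * x) * (norm x)\<^sup>2 + \<rho> * (norm x)\<^sup>2 + Im (V * x\<^sup>2) + Im (G * x) + h = 0"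
  shows "U = 0" "\<rho> = 0" "V = 0" "G = 0" "h = 0"
proof -
  note E = assms[unfolded cmod_power2]
  have "h = 0" using E[of 0] by simp
  moreover have "\<rho> = 0" "Im U = 0" "Re U = 0" "Im V = 0" "Re V = 0" "Im G = 0" "Re G = 0"
    \<comment> \<open>These sample points give a linear system in the eight real coefficients whose
      only solution is zero.\<close>
    using E[of 0] E[of 1] E[of "-1"] E[of \<i>] E[of "-\<i>"] E[of 2] E[of "2 * \<i>"] E[of "1 + \<i>"]
       E[of "-2"] E[of "- 2 * \<i>"] E[of "-1-\<i>"]
    by (simp_all add: power2_eq_square)
  ultimately show "U = 0" "\<rho> = 0" "V = 0" "G = 0" "h = 0" by (auto simp: complex_eq_iff)
qed

text \<open>Conjugating the last term makes it linear in \<open>x\<close>, the shape required for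
  comparing coefficients.\<close>

lemma iso_form_1:
  "iso_form w m k x 1 = Im (cnj w * x) * (norm x)\<^sup>2 - k * (norm x)\<^sup>2 - Im (w * cnj m * x)"
  by (simp add: iso_form_def algebra_simps)

text \<open>Homogeneity carries the affine equation to all \<open>t\<close> other than 0; the points
  at infinity follow by continuity in \<open>t\<close>.\<close>

lemma ev_eq_iso_form:
  assumes "homogeneous 3 F" "\<And>x. ev F (x, 1) = iso_form w m k (x - p) 1"
  shows "ev F (x, t) = iso_form w m k (x - of_real t * p) t"
proof -
  have nz: "ev F (x, t) = iso_form w m k (x - of_real t * p) t" if "t \<noteq> 0" for t
  proof -
    have "ev F (x, t) = t ^ 3 * ev F (x / of_real t, 1)"
      using assms(1)[unfolded homogeneous_def, rule_format, of t "(x / of_real t, 1)"] that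
      by (simp add: scaleR_conv_of_real)
    also have "\<dots> = t ^ 3 * iso_form w m k ((x - of_real t * p) / of_real t) 1"
      using that by (simp add: assms(2) diff_divide_distrib)
    also have "\<dots> = iso_form w m k (x - of_real t * p) t"
    proof -
      define y where "y = x - of_real t * p"
      show ?thesis unfolding y_def[symmetric] iso_form_def cmod_power2
        using that by (simp add: field_simps power2_eq_square power3_eq_cube)
    qed
    finally show ?thesis .
  qed
  show ?thesis
  proof (cases "t = 0")
    case True
    have "((\<lambda>t. ev F (x, t)) \<longlongrightarrow> ev F (x, 0)) (at 0)"
      unfolding ev_def by (auto intro!: tendsto_eq_intros isContD poly_isCont)
    moreover have "((\<lambda>t. ev F (x, t)) \<longlongrightarrow> iso_form w m k (x - of_real 0 * p) 0) (at 0)"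
    proof (rule Lim_transform_eventually)
      show "((\<lambda>t. iso_form w m k (x - of_real t * p) t) \<longlongrightarrow> iso_form w m k (x - of_real 0 * p) 0) (at 0)"
        unfolding iso_form_def by (intro tendsto_intros)
      show "\<forall>\<^sub>F t in at 0. iso_form w m k (x - of_real t * p) t = ev F (x, t)"
        by (auto simp: eventually_at_filter nz)
    qed
    ultimately show ?thesis using True by (auto dest: tendsto_unique[rotated])
  qed (rule nz)
qed

text \<open>The equation is a number minus its conjugate, hence \<open>2 * \<i>\<close> times an
  imaginary part. The center \<open>p\<close> is left arbitrary.\<close>

lemma isogonal_cubic_of_ev:
  assumes "isogonal_cubic_of F a b c d"
  obtains \<mu> where "\<mu> \<noteq> 0"
    "\<And>x. complex_of_real (ev F (p + x, 1)) = \<mu> *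
      of_real (Im ((x\<^sup>2 - ((b - p) + (d - p)) * x + (b - p) * (d - p)) *
              cnj (x\<^sup>2 - ((a - p) + (c - p)) * x + (a - p) * (c - p))))"
proof -
  obtain \<kappa> where \<kappa>: "\<kappa> \<noteq> 0" "\<And>x. complex_of_real (ev F (x, 1)) =
        \<kappa> * ((x - b) * (x - d) * cnj ((x - a) * (x - c))
           - cnj ((x - b) * (x - d)) * ((x - a) * (x - c)))"
    using assms unfolding isogonal_cubic_of_def by blast
  have im: "M * cnj N - cnj M * N = 2 * \<i> * of_real (Im (M * cnj N))" for M N
    by (simp add: complex_eq_iff)
  have sq: "(p + x - u) * (p + x - v) = x\<^sup>2 - ((u - p) + (v - p)) * x + (u - p) * (v - p)" for u v x
    by (simp add: algebra_simps power2_eq_square)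
  show ?thesis
    by (rule that[of "2 * \<i> * \<kappa>"]) (use \<kappa>(1) in \<open>simp_all only: \<kappa>(2) im sq\<close>, auto simp: mult_ac)
qed

text \<open>Centered at the spiral center, both vertex pairs have the product \<open>m\<close>, so
  the term in \<open>x^2\<close> and the constant term of \<open>isogonal_equation_expand\<close>
  vanish.\<close>

lemma spiral_center_normal_form:
  assumes "isogonal_cubic_of F a b c d" "(a - p) * (c - p) = (b - p) * (d - p)"
  obtains w m k where "w \<noteq> 0" "m \<noteq> 0"
    "\<And>x t. ev F (x, t) = iso_form w m k (x - of_real t * p) t"
proof -
  have dist: "distinct [a, b, c, d]" and hom: "homogeneous 3 F"
    using assms(1) by (auto simp: isogonal_cubic_of_def)
  define m where "m = (a - p) * (c - p)"
  define w0 where "w0 = (b - p) + (d - p) - ((a - p) + (c - p))"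
  define k0 where "k0 = - Im (((b - p) + (d - p)) * cnj ((a - p) + (c - p)))"
  have "m \<noteq> 0" using dist assms(2) by (auto simp: m_def)
  \<comment> \<open>If \<open>w0\<close> were 0, this identity would give \<open>a = b\<close> or
    \<open>a = d\<close>.\<close>
  have "(a - b) * (a - d) = (a - p) * (a - b - d + c)"
    using assms(2) by (simp add: algebra_simps)
  moreover have "a - b - d + c = - w0" by (simp add: w0_def)
  ultimately have "w0 \<noteq> 0" using dist by auto
  obtain \<mu> where \<mu>: "\<mu> \<noteq> 0" "\<And>x. complex_of_real (ev F (p + x, 1)) = \<mu> * of_real (iso_form w0 m k0 x 1)"
  proof -
    have "Im ((x\<^sup>2 - ((b - p) + (d - p)) * x + (b - p) * (d - p)) *
              cnj (x\<^sup>2 - ((a - p) + (c - p)) * x + (a - p) * (c - p))) = iso_form w0 m k0 x 1" for x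
      unfolding isogonal_equation_expand iso_form_1 assms(2)[symmetric] m_def[symmetric]
      by (simp add: w0_def k0_def algebra_simps)
    with isogonal_cubic_of_ev[OF assms(1), of p] that show thesis by metis
  qed
  \<comment> \<open>Since \<open>F\<close> takes real values and \<open>iso_form\<close> is not
    identically zero, \<open>\<mu>\<close> must be real.\<close>
  have "Im \<mu> * iso_form w0 m k0 x 1 = 0" for x using arg_cong[OF \<mu>(2)[of x], of Im] by simp
  moreover have "\<exists>x. iso_form w0 m k0 x 1 \<noteq> 0"
  proof (rule ccontr)
    assume "\<nexists>x. iso_form w0 m k0 x 1 \<noteq> 0"
    then have "cnj w0 = 0"
      using cubic_coefficients_eq_0(1)[of "cnj w0" "- k0" 0 "- w0 * cnj m" 0] by (simp add: iso_form_1)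
    with \<open>w0 \<noteq> 0\<close> show False by simp
  qed
  ultimately have "Im \<mu> = 0" by auto
  then have "Re \<mu> \<noteq> 0" using \<mu>(1) by (simp add: complex_eq_iff)
  show thesis
  \<comment> \<open>For fixed \<open>m\<close> the form is real-linear in the pair of
    \<open>w\<close> and \<open>k\<close>, so the real factor is absorbed there.\<close>
  proof (rule that[of "of_real (Re \<mu>) * w0" m "Re \<mu> * k0"])
    show "of_real (Re \<mu>) * w0 \<noteq> 0" "m \<noteq> 0"
      using \<open>Re \<mu> \<noteq> 0\<close> \<open>w0 \<noteq> 0\<close> \<open>m \<noteq> 0\<close> by auto
    have "ev F (x, 1) = Re \<mu> * iso_form w0 m k0 (x - p) 1" for x
      using arg_cong[OF \<mu>(2)[of "x - p"], of Re] by simp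
    moreover have "Re \<mu> * iso_form w0 m k0 y 1 = iso_form (of_real (Re \<mu>) * w0) m (Re \<mu> * k0) y 1" for y
      by (simp add: iso_form_1 algebra_simps)
    ultimately have "ev F (x, 1) = iso_form (of_real (Re \<mu>) * w0) m (Re \<mu> * k0) (x - p) 1" for x
      by simp
    with hom show "ev F (x, t) = iso_form (of_real (Re \<mu>) * w0) m (Re \<mu> * k0) (x - of_real t * p) t" for x t
      by (rule ev_eq_iso_form)
  qed
qed

text \<open>The converse of the normal form: comparing coefficients ties every quadrilateral with
  this cubic to the same \<open>p\<close>, \<open>m\<close> and direction \<open>w\<close>. This is
  why conjugation does not depend on the quadrilateral.\<close>

lemma isogonal_cubic_of_normal_form:
  assumes "isogonal_cubic_of F a b c d" "w \<noteq> 0"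
    "\<And>x t. ev F (x, t) = iso_form w m k (x - of_real t * p) t"
  shows "(a - p) * (c - p) = m" "(b - p) * (d - p) = m" "(a + c - b - d) / w \<in> \<real>"
proof -
  let ?q = "(b - p) + (d - p)" and ?s = "(a - p) + (c - p)"
  let ?n = "(b - p) * (d - p)" and ?l = "(a - p) * (c - p)"
  obtain \<mu> where \<mu>: "\<mu> \<noteq> 0" "\<And>x. complex_of_real (ev F (p + x, 1)) =
     \<mu> * of_real (Im ((x\<^sup>2 - ?q * x + ?n) * cnj (x\<^sup>2 - ?s * x + ?l)))"
    using isogonal_cubic_of_ev[OF assms(1), of p] by metis
  define r where "r = Re \<mu>"
  have eq: "iso_form w m k x 1 = r * Im ((x\<^sup>2 - ?q * x + ?n) * cnj (x\<^sup>2 - ?s * x + ?l))" for x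
    using arg_cong[OF \<mu>(2)[of x], of Re] by (simp add: assms(3) r_def)
  have "Im ((of_real r * (cnj ?q - cnj ?s) - cnj w) * x) * (norm x)\<^sup>2
      + (r * Im (?q * cnj ?s) + k) * (norm x)\<^sup>2
      + Im (of_real r * (cnj ?l - cnj ?n) * x\<^sup>2)
      + Im ((of_real r * (cnj ?n * ?s - ?q * cnj ?l) + w * cnj m) * x) + r * Im (?n * cnj ?l) = 0" for x
    using eq[of x] unfolding isogonal_equation_expand iso_form_1
    by (simp add: algebra_simps)
  note * = cubic_coefficients_eq_0[OF this]
  from *(1) have w: "of_real r * (?q - ?s) = w"
    by (metis complex_cnj_cnj complex_cnj_complex_of_real complex_cnj_diff complex_cnj_mult eq_iff_diff_eq_0)
  with assms(2) have r: "r \<noteq> 0" "?q - ?s \<noteq> 0" by force+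
  from r(1) *(3) have "cnj ?l = cnj ?n" by (metis mult_eq_0_iff of_real_eq_0_iff eq_iff_diff_eq_0)
  then have ln: "?l = ?n" by (metis complex_cnj_cnj)
  \<comment> \<open>With equal products, the linear coefficient has the factor
    \<open>?q - ?s\<close>, which the cubic coefficient has identified with \<open>w\<close> up to
    the real number \<open>r\<close>.\<close>
  from *(4) have "w * (cnj m - cnj ?l) = 0"
    unfolding ln w[symmetric] by (simp add: algebra_simps)
  then have "cnj m = cnj ?l" using assms(2) by simp
  then show "?l = m" by (metis complex_cnj_cnj)
  with ln show "?n = m" by simp
  have qs: "?q - ?s = b + d - (a + c)" by simp
  have "(a + c - b - d) / w = of_real (- 1 / r)"
    using r assms(2) unfolding w[symmetric] qs by (simp add: field_simps)
  then show "(a + c - b - d) / w \<in> \<real>" by (simp only: Reals_of_real)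
qed

text \<open>If \<open>(cnj w)^2 * m\<close> is real, then \<open>cnj w * m = c * w\<close> with
  \<open>c\<close> real. With \<open>k = 0\<close> and \<open>y = x - t * p\<close> the form becomes
  \<open>Im (cnj w * y)\<close> times \<open>(norm y)^2 - c * t^2\<close>; these factors are
  \<open>G\<close> and \<open>H\<close>.\<close>

lemma irreducible_normal_form_nondegenerate:
  assumes "irreducible F" "w \<noteq> 0"
    "\<And>x t. ev F (x, t) = iso_form w m k (x - of_real t * p) t"
  shows "\<not> (k = 0 \<and> Im ((cnj w)\<^sup>2 * m) = 0)"
proof
  assume *: "k = 0 \<and> Im ((cnj w)\<^sup>2 * m) = 0"
  define c where "c = Re ((cnj w)\<^sup>2 * m) / (norm w)\<^sup>2"
  have "(cnj w)\<^sup>2 * m = of_real (c * (norm w)\<^sup>2)"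
    using * assms(2) by (simp add: c_def complex_eq_iff)
  also have "\<dots> = of_real c * (w * cnj w)" by (simp flip: complex_norm_square)
  finally have cm: "cnj w * m = of_real c * w" using assms(2) by (simp add: power2_eq_square)
  let ?X = "[:0, 1:] - [:[:[:Re p:]:]:] * [:[:[:0, 1:]:]:] :: form"
  let ?Y = "[:[:0, 1:]:] - [:[:[:Im p:]:]:] * [:[:[:0, 1:]:]:] :: form"
  let ?Z = "[:[:[:0, 1:]:]:] :: form"
  define G where "G = [:[:[:Re w:]:]:] * ?Y - [:[:[:Im w:]:]:] * ?X"
  define H where "H = ?X * ?X + ?Y * ?Y - [:[:[:c:]:]:] * (?Z * ?Z)"
  note ev_simps = ev_add ev_diff ev_mult ev_const ev_X ev_Y ev_Z
  have G: "ev G (x, t) = Im (cnj w * (x - of_real t * p))" for x t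
    unfolding G_def ev_simps by (simp add: algebra_simps)
  have H: "ev H (x, t) = (norm (x - of_real t * p))\<^sup>2 - c * t\<^sup>2" for x t
    unfolding H_def ev_simps cmod_power2 by (simp add: algebra_simps power2_eq_square)
  have "ev F (x, t) = ev G (x, t) * ev H (x, t)" for x t
    unfolding assms(3) G H iso_form_def cm using * by (simp add: algebra_simps)
  then have "\<not> irreducible F"
    by (intro not_irreducible_of_ev_eq_mult[of F G H "(0, 0)" "(0, 0)"]) (auto simp: G H)
  with assms(1) show False by simp
qed

section \<open>Isogonal conjugation on the cubic\<close>

locale iso_cubic =
  fixes F :: form and p w m :: complex and k :: real
  assumes w_nz: "w \<noteq> 0" and m_nz: "m \<noteq> 0"
    and ev_F: "\<And>x t. ev F (x, t) = iso_form w m k (x - of_real t * p) t"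
    and nondegenerate: "\<not> (k = 0 \<and> Im ((cnj w)\<^sup>2 * m) = 0)"
begin

section \<open>Polarization, points and tangents of the cubic\<close>

definition polar :: "complex \<Rightarrow> real \<Rightarrow> complex \<Rightarrow> real \<Rightarrow> real" where
  "polar x t y u = Im (cnj w * y) * (norm x)\<^sup>2 + 2 * Re (cnj x * y) * (Im (cnj w * x) - t * k)
     - u * k * (norm x)\<^sup>2 + 2 * t * u * Im (cnj w * m * cnj x) + t\<^sup>2 * Im (cnj w * m * cnj y)"

definition polar_vec :: "complex \<times> real \<Rightarrow> complex \<times> real \<Rightarrow> real" where
  "polar_vec v v' = polar (fst v - of_real (snd v) * p) (snd v) (fst v' - of_real (snd v') * p) (snd v')"

text \<open>This identifies \<open>polar x t y u\<close> as the derivative of the form at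
  \<open>(x, t)\<close> in the direction \<open>(y, u)\<close>. It serves both the tangents and the
  restriction of the cubic to a line.\<close>

lemma iso_form_combination:
  "iso_form w m k (of_real s * x + of_real r * y) (s * t + r * u) =
    s ^ 3 * iso_form w m k x t + s\<^sup>2 * r * polar x t y u + s * r\<^sup>2 * polar y u x t + r ^ 3 * iso_form w m k y u"
  unfolding iso_form_def polar_def cmod_power2
  by (simp add: algebra_simps power2_eq_square power3_eq_cube)

lemma ev_combination:
  "ev F (s *\<^sub>R v + r *\<^sub>R v') =
    s ^ 3 * ev F v + s\<^sup>2 * r * polar_vec v v' + s * r\<^sup>2 * polar_vec v' v + r ^ 3 * ev F v'"
proof (cases v; cases v')
  fix x t y u assume [simp]: "v = (x, t)" "v' = (y, u)"
  have "ev F (s *\<^sub>R v + r *\<^sub>R v') = iso_form w m k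
     (of_real s * (x - of_real t * p) + of_real r * (y - of_real u * p)) (s * t + r * u)"
    by (simp add: ev_F scaleR_conv_of_real algebra_simps)
  then show ?thesis
    unfolding iso_form_combination by (simp add: ev_F polar_vec_def)
qed

lemma ev_scale: "ev F (s *\<^sub>R v) = s ^ 3 * ev F v"
  using ev_combination[of s v 0 v] by simp

lemma span_in_curve_iff: "v \<noteq> 0 \<Longrightarrow> span {v} \<in> curve F \<longleftrightarrow> ev F v = 0"
proof -
  assume "v \<noteq> 0"
  then have "span {v} \<in> rp2" by (force simp only: rp2_def)
  moreover have "(\<forall>u\<in>span {v}. ev F u = 0) \<longleftrightarrow> ev F v = 0"
    using span_base[of v "{v}"] by (auto simp: span_singleton ev_scale)
  ultimately show ?thesis by (simp add: curve_def)
qed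

lemma curve_subset_rp2: "X \<in> curve F \<Longrightarrow> X \<in> rp2"
  by (simp add: curve_def)

text \<open>The derivative is the coefficient of the linear term in \<open>ev_combination\<close>. A
  multiple \<open>c\<close> of \<open>v\<close> contributes only the factor
  \<open>c^2\<close>.\<close>

lemma mem_tangent_iff:
  assumes "ev F v = 0"
  shows "v' \<in> tangent F (span {v}) \<longleftrightarrow> polar_vec v v' = 0"
proof -
  have "((\<lambda>t. ev F (c *\<^sub>R v + t *\<^sub>R v')) has_real_derivative c\<^sup>2 * polar_vec v v') (at 0)" for c
    unfolding ev_combination assms by (auto intro!: derivative_eq_intros)
  then have "((\<lambda>t. ev F (c *\<^sub>R v + t *\<^sub>R v')) has_real_derivative 0) (at 0) \<longleftrightarrow> c\<^sup>2 * polar_vec v v' = 0" for c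
    using DERIV_unique by metis
  then show ?thesis
    unfolding tangent_def by (auto simp: span_singleton)
qed

text \<open>The coordinate \<open>x\<close> is relative to \<open>p\<close>. The spiral center
  \<open>x = 0\<close> lies on the cubic but is kept apart, because its conjugate is at
  infinity.\<close>

definition on_curve :: "complex \<Rightarrow> bool" where
  "on_curve x \<longleftrightarrow> x \<noteq> 0 \<and> Im (cnj w * (x + m / x)) = k"

lemma iso_form_eq:
  assumes "x \<noteq> 0"
  shows "iso_form w m k x 1 = (norm x)\<^sup>2 * (Im (cnj w * (x + m / x)) - k)"
proof -
  have "cnj x = of_real ((norm x)\<^sup>2) / x" using assms unfolding complex_norm_square by simp
  then have "cnj w * m * cnj x = of_real ((norm x)\<^sup>2) * (cnj w * (m / x))" by simp
  then have "Im (cnj w * m * cnj x) = (norm x)\<^sup>2 * Im (cnj w * (m / x))"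
    by (simp only: Im_of_real_mult)
  then show ?thesis by (simp add: iso_form_def algebra_simps)
qed

lemma fin_in_curve_iff: "fin_pt (p + x) \<in> curve F \<longleftrightarrow> x = 0 \<or> on_curve x"
proof -
  have "fin_pt (p + x) \<in> curve F \<longleftrightarrow> iso_form w m k x 1 = 0"
    unfolding fin_pt_def by (subst span_in_curve_iff) (auto simp: zero_prod_def ev_F)
  also have "\<dots> \<longleftrightarrow> x = 0 \<or> on_curve x"
    by (cases "x = 0") (auto simp: iso_form_eq on_curve_def, simp add: iso_form_def)
  finally show ?thesis .
qed

lemma inf_in_curve_iff: "e \<noteq> 0 \<Longrightarrow> inf_pt e \<in> curve F \<longleftrightarrow> inf_pt e = inf_pt w"
proof -
  assume e: "e \<noteq> 0"
  then have "inf_pt e \<in> curve F \<longleftrightarrow> iso_form w m k e 0 = 0"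
    unfolding inf_pt_def by (subst span_in_curve_iff) (auto simp: zero_prod_def ev_F)
  also have "\<dots> \<longleftrightarrow> Im (cnj w * e) = 0" using e by (simp add: iso_form_def)
  also have "\<dots> \<longleftrightarrow> inf_pt e = inf_pt w"
    unfolding inf_pt_eq_iff[OF e w_nz] divide_in_Reals_iff[OF w_nz] ..
  finally show ?thesis .
qed

lemma curve_cases:
  assumes "X \<in> curve F"
  obtains "X = fin_pt p" | "X = inf_pt w" | x where "on_curve x" "X = fin_pt (p + x)"
proof (cases rule: rp2_cases[OF curve_subset_rp2[OF assms]])
  case (1 x)
  then show ?thesis using assms fin_in_curve_iff[of "x - p"] that(1,3) by auto
next
  case (2 e)
  then show ?thesis using assms inf_in_curve_iff that(2) by auto
qed

lemma P_in_curve: "fin_pt p \<in> curve F" using fin_in_curve_iff[of 0] by simp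
lemma Pinf_in_curve: "inf_pt w \<in> curve F" using inf_in_curve_iff[OF w_nz] by simp

text \<open>At \<open>x = 0\<close> only the last term of \<open>polar\<close> survives; it vanishes
  when \<open>y\<close> is a real multiple of \<open>m * cnj w\<close>.\<close>

lemma tangent_at_P: "tangent F (fin_pt p) = affine_line p (m * cnj w)"
proof -
  have "(z, t) \<in> tangent F (fin_pt p) \<longleftrightarrow> (z, t) \<in> affine_line p (m * cnj w)" for z t
  proof -
    define y where "y = z - of_real t * p"
    have "(z, t) \<in> tangent F (fin_pt p) \<longleftrightarrow> polar 0 1 y t = 0"
      unfolding fin_pt_def by (subst mem_tangent_iff) (auto simp: ev_F iso_form_def polar_vec_def y_def)
    also have "\<dots> \<longleftrightarrow> Im (cnj (m * cnj w) * y) = 0"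
      by (simp add: polar_def) (auto simp: algebra_simps)
    also have "\<dots> \<longleftrightarrow> y / (m * cnj w) \<in> \<real>"
      using w_nz m_nz by (intro divide_in_Reals_iff[symmetric]) auto
    finally show ?thesis using w_nz m_nz by (simp add: mem_affine_line y_def)
  qed
  then show ?thesis by auto
qed

text \<open>The real asymptote is \<open>Im (cnj w * y) = k\<close>; the base point is chosen so
  that \<open>cnj w * y = \<i> * k\<close>.\<close>

lemma tangent_at_Pinf: "tangent F (inf_pt w) = affine_line (p + \<i> * of_real k / cnj w) w"
proof -
  have "(z, t) \<in> tangent F (inf_pt w) \<longleftrightarrow> (z, t) \<in> affine_line (p + \<i> * of_real k / cnj w) w" for z t
  proof -
    define y where "y = z - of_real t * p"
    have "(z, t) \<in> tangent F (inf_pt w) \<longleftrightarrow> polar w 0 y t = 0"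
      unfolding inf_pt_def by (subst mem_tangent_iff) (auto simp: ev_F iso_form_def polar_vec_def y_def)
    also have "\<dots> \<longleftrightarrow> (Im (cnj w * y) - t * k) * (norm w)\<^sup>2 = 0"
      by (simp add: polar_def algebra_simps)
    also have "\<dots> \<longleftrightarrow> Im (cnj w * (y - of_real t * (\<i> * of_real k / cnj w))) = 0"
      using w_nz by (simp add: right_diff_distrib)
    also have "\<dots> \<longleftrightarrow> (y - of_real t * (\<i> * of_real k / cnj w)) / w \<in> \<real>"
      using w_nz by (intro divide_in_Reals_iff[symmetric])
    finally show ?thesis using w_nz by (simp add: mem_affine_line y_def algebra_simps)
  qed
  then show ?thesis by auto
qed

text \<open>Differentiating \<open>Im (cnj w * (x + m / x))\<close> along \<open>y\<close> gives
  \<open>Im (cnj w * (x - m / x) * (y / x))\<close>, up to a real factor \<open>Im (y / d)\<close>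
  for the direction \<open>d\<close> stated. At a fixed point of \<open>x \<mapsto> m / x\<close>
  the derivative vanishes and the point is singular.\<close>

lemma tangent_at_fin:
  assumes "on_curve x" "x\<^sup>2 \<noteq> m"
  shows "tangent F (fin_pt (p + x)) = affine_line (p + x) (x * w / (m / x - x))"
proof -
  have x: "x \<noteq> 0" and k: "k = Im (cnj w * (x + m / x))" using assms by (auto simp: on_curve_def)
  define d where "d = x * w / (m / x - x)"
  have mx: "m / x - x \<noteq> 0" using x assms(2) by (simp add: field_simps power2_eq_square)
  then have d: "d \<noteq> 0" using x w_nz by (simp add: d_def)
  have "(z, t) \<in> tangent F (fin_pt (p + x)) \<longleftrightarrow> (z, t) \<in> affine_line (p + x) d" for z t
  proof -
    define y where "y = z - of_real t * (p + x)"
    define h where "h = y / x"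
    define M where "M = cnj w * m / x"
    have ev1: "iso_form w m k x 1 = 0" unfolding iso_form_eq[OF x] k[symmetric] by simp
    then have ev0: "ev F (p + x, 1) = 0" by (simp add: ev_F)
    have y: "y = x * h" using x by (simp add: h_def)
    have "(z, t) \<in> tangent F (fin_pt (p + x)) \<longleftrightarrow> polar x 1 (z - of_real t * p) t = 0"
      unfolding fin_pt_def by (subst mem_tangent_iff) (auto simp: ev0 polar_vec_def)
    \<comment> \<open>Euler's relation: the component along the point itself contributes three times
      the value of the form.\<close>
    also have "polar x 1 (z - of_real t * p) t = polar x 1 y 0 + t * (3 * iso_form w m k x 1)"
      unfolding polar_def iso_form_def cmod_power2 y_def by (simp add: algebra_simps power2_eq_square)
    also have "\<dots> = polar x 1 y 0" by (simp add: ev1)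
    also have "\<dots> = (norm x)\<^sup>2 * Im (cnj w * (x - m / x) * h)"
    proof -
      have "cnj w * m = M * x" "k = Im (cnj w * x) + Im M" "cnj w * (x - m / x) = cnj w * x - M"
        using x k by (simp_all add: M_def algebra_simps)
      then show ?thesis unfolding polar_def y cmod_power2
        by (simp only:) (simp add: algebra_simps power2_eq_square)
    qed
    also have "cnj w * (x - m / x) * h = - (of_real ((norm w)\<^sup>2) * (y / d))"
      using x mx w_nz unfolding h_def d_def complex_norm_square by (simp add: field_simps)
    finally have "(z, t) \<in> tangent F (fin_pt (p + x)) \<longleftrightarrow> (norm x)\<^sup>2 * - ((norm w)\<^sup>2 * Im (y / d)) = 0"
      by (simp only: uminus_complex.sel Im_of_real_mult)
    then have "(z, t) \<in> tangent F (fin_pt (p + x)) \<longleftrightarrow> Im (y / d) = 0"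
      using x w_nz by simp
    then show ?thesis using d by (simp add: mem_affine_line y_def complex_is_Real_iff)
  qed
  then show ?thesis by (auto simp: d_def)
qed

section \<open>The conjugation map and its isogonal lines\<close>

lemmas over_w_in_Reals_iff = divide_in_Reals_iff[OF w_nz]

definition conj_pt :: "subsp \<Rightarrow> subsp \<Rightarrow> bool" where
  "conj_pt Z Z' \<longleftrightarrow> Z = fin_pt p \<and> Z' = inf_pt w \<or> Z = inf_pt w \<and> Z' = fin_pt p \<or>
     (\<exists>z. on_curve z \<and> Z = fin_pt (p + z) \<and> Z' = fin_pt (p + m / z))"

lemma on_curve_conj: "on_curve z \<Longrightarrow> on_curve (m / z)"
  using m_nz by (simp add: on_curve_def add.commute)

lemma conj_pt_exists: "Z \<in> curve F \<Longrightarrow> \<exists>Z'. conj_pt Z Z'"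
  by (elim curve_cases) (auto simp: conj_pt_def)

lemma conj_pt_in_curve: "conj_pt Z Z' \<Longrightarrow> Z \<in> curve F" "conj_pt Z Z' \<Longrightarrow> Z' \<in> curve F"
  by (auto simp: conj_pt_def P_in_curve Pinf_in_curve fin_in_curve_iff on_curve_conj)

lemma conj_pt_commute: "conj_pt Z Z' \<Longrightarrow> conj_pt Z' Z"
  unfolding conj_pt_def using on_curve_conj m_nz
  by (elim disjE exE conjE) (auto simp: on_curve_def intro!: exI[of _ "m / _"])

text \<open>
  The last assumption excludes exactly the case that \<open>Z\<close> is the point \<open>p + u\<close> and singular; the
  line join would then be the whole space.
\<close>

lemma line_joins_to_conjugates:
  assumes u: "on_curve u" and conj: "conj_pt Z Z'"
    and smooth: "\<not> (Z = fin_pt (p + u) \<and> Z' = fin_pt (p + u))"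
  obtains d1 d2 where "d1 \<noteq> 0" "d2 \<noteq> 0" "line_join F (fin_pt (p + u)) Z = affine_line (p + u) d1"
    "line_join F (fin_pt (p + u)) Z' = affine_line (p + u) d2" "d1 * d2 / (u * w) \<in> \<real>"
proof -
  have [simp]: "u \<noteq> 0" using u by (simp add: on_curve_def)
  have tangent: "line_join F (fin_pt (p + u)) (fin_pt (p + u)) = affine_line (p + u) (u * w / (m / u - u))"
    if "m / u \<noteq> u"
    using that tangent_at_fin[OF u] by (simp add: line_join_def field_simps power2_eq_square)
  have P: "line_join F (fin_pt (p + u)) (fin_pt p) = affine_line (p + u) (- u)"
    by (simp add: line_join_fin_fin)
  consider "Z = fin_pt p" "Z' = inf_pt w" | "Z = inf_pt w" "Z' = fin_pt p"
    | z where "on_curve z" "Z = fin_pt (p + z)" "Z' = fin_pt (p + m / z)"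
    using conj by (auto simp: conj_pt_def)
  then show thesis
  proof cases
    case 1
    then show ?thesis
      using w_nz by (intro that[of "- u" w]) (auto simp: P line_join_fin_inf)
  next
    case 2
    then show ?thesis
      using w_nz by (intro that[of w "- u"]) (auto simp: P line_join_fin_inf mult.commute)
  next
    case (3 z)
    then have [simp]: "z \<noteq> 0" by (simp add: on_curve_def)
    consider "z = u" | "m / z = u" "z \<noteq> u" | "z \<noteq> u" "m / z \<noteq> u" by blast
    then show ?thesis
    proof cases
      case 1
      \<comment> \<open>One join is now the tangent. Its direction has the denominator
        \<open>m / u - u\<close>, which is the direction of the other join, so the product is
        exactly \<open>u * w\<close>.\<close>
      then have "m / u \<noteq> u" using smooth 3 by auto
      with 1 3 show ?thesis using w_nz
        by (intro that[of "u * w / (m / u - u)" "m / u - u"])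
          (auto simp: tangent line_join_fin_fin)
    next
      case 2
      then have z: "z = m / u" by (auto simp: field_simps)
      with 2 have "m / u \<noteq> u" by auto
      with z 2 3 show ?thesis using w_nz
        by (intro that[of "m / u - u" "u * w / (m / u - u)"])
          (auto simp: tangent line_join_fin_fin)
    next
      case neq: 3
      have "(z - u) * (m / z - u) / (u * w) = ((u + m / u) - (z + m / z)) / w"
        using w_nz by (simp add: field_simps)
      moreover have "Im (cnj w * ((u + m / u) - (z + m / z))) = 0"
        using u 3(1) unfolding on_curve_def right_diff_distrib minus_complex.sel by simp
      then have "((u + m / u) - (z + m / z)) / w \<in> \<real>"
        unfolding over_w_in_Reals_iff .
      ultimately have "(z - u) * (m / z - u) / (u * w) \<in> \<real>" by simp
      with neq 3 show ?thesis
        by (intro that[of "z - u" "m / z - u"]) (auto simp: line_join_fin_fin)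
    qed
  qed
qed

lemma line_join_P_P: "line_join F (fin_pt p) (fin_pt p) = affine_line p (m * cnj w)"
  by (simp add: line_join_def tangent_at_P)

lemma line_join_Pinf_Pinf: "line_join F (inf_pt w) (inf_pt w) = affine_line (p + \<i> * of_real k / cnj w) w"
  by (simp add: line_join_def tangent_at_Pinf)

lemma line_join_fin_P: "u \<noteq> 0 \<Longrightarrow> line_join F (fin_pt (p + u)) (fin_pt p) = affine_line (p + u) (- u)"
  by (simp add: line_join_fin_fin)

lemma line_join_P_fin: "u \<noteq> 0 \<Longrightarrow> line_join F (fin_pt p) (fin_pt (p + u)) = affine_line p u"
  by (simp add: line_join_fin_fin)

lemma Im_cnj_w_k: "Im (cnj w * (\<i> * of_real k / cnj w)) = k"
  using w_nz by simp

text \<open>At a finite \<open>U\<close> other than the spiral center this is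
  \<open>line_joins_to_conjugates\<close>. At the spiral center and at infinity the tangent enters
  as one of the reference lines. The excluded case is a self-conjugate \<open>Z\<close> equal to
  \<open>U\<close>.\<close>

lemma conjugate_lines_isogonal:
  assumes "U \<in> curve F" "conj_pt Z Z'" "\<not> (Z = U \<and> Z' = U)"
  shows "isogonal U (line_join F U Z) (line_join F U Z')
           (line_join F U (fin_pt p)) (line_join F U (inf_pt w))"
proof (cases rule: curve_cases[OF assms(1)])
  case 1
  have mw: "m * cnj w \<noteq> 0" using m_nz w_nz by simp
  consider "Z = fin_pt p" "Z' = inf_pt w" | "Z = inf_pt w" "Z' = fin_pt p"
    | z where "on_curve z" "Z = fin_pt (p + z)" "Z' = fin_pt (p + m / z)"
    using assms(2) by (auto simp: conj_pt_def)
  then show ?thesis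
  proof cases
    case (3 z)
    then have z: "z \<noteq> 0" "m / z \<noteq> 0" using m_nz by (auto simp: on_curve_def)
    \<comment> \<open>The directions to the conjugates multiply to \<open>m\<close>, those of the
      tangent and of the line to infinity to \<open>m * (norm w)^2\<close>.\<close>
    have "z * (m / z) / (m * cnj w * w) = of_real (1 / (norm w)\<^sup>2)"
      using z m_nz w_nz unfolding of_real_divide complex_norm_square by (simp add: field_simps)
    then have "z * (m / z) / (m * cnj w * w) \<in> \<real>" by (simp only: Reals_of_real)
    then show ?thesis
      unfolding 1 3 line_join_P_P line_join_P_fin[OF z(1)] line_join_P_fin[OF z(2)] line_join_fin_inf
        isogonal_fin_iff[OF z mw w_nz] .
  qed (use 1 mw w_nz in \<open>simp_all add: line_join_P_P line_join_fin_inf isogonal_fin_iff mult.commute\<close>)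
next
  case 2
  consider "Z = fin_pt p" "Z' = inf_pt w" | "Z = inf_pt w" "Z' = fin_pt p"
    | z where "on_curve z" "Z = fin_pt (p + z)" "Z' = fin_pt (p + m / z)"
    using assms(2) by (auto simp: conj_pt_def)
  then show ?thesis
  proof cases
    case (3 z)
    \<comment> \<open>At infinity the criterion is additive, and the sum \<open>z + m / z\<close> is
      exactly what the equation of the cubic controls.\<close>
    then have "Im (cnj w * ((z + m / z) - \<i> * of_real k / cnj w)) = 0"
      unfolding right_diff_distrib minus_complex.sel Im_cnj_w_k by (simp add: on_curve_def)
    then have "((z + m / z) - \<i> * of_real k / cnj w) / w \<in> \<real>"
      unfolding over_w_in_Reals_iff .
    then show ?thesis
      using 2 3 w_nz by (simp add: line_join_Pinf_Pinf line_join_inf_fin isogonal_inf_iff algebra_simps)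
  qed (use 2 w_nz in \<open>simp_all add: line_join_Pinf_Pinf line_join_inf_fin isogonal_inf_iff\<close>)
next
  case (3 u)
  then have u: "u \<noteq> 0" by (simp add: on_curve_def)
  from line_joins_to_conjugates[OF 3(1) assms(2)] assms(3) 3(2)
  obtain d1 d2 where d: "d1 \<noteq> 0" "d2 \<noteq> 0" "line_join F U Z = affine_line (p + u) d1"
    "line_join F U Z' = affine_line (p + u) d2" "d1 * d2 / (u * w) \<in> \<real>" by metis
  from d(5) have "d1 * d2 / (- u * w) \<in> \<real>" using Reals_minus[OF d(5)] by simp
  then show ?thesis
    using d u w_nz unfolding 3(2) by (simp add: line_join_fin_P line_join_fin_inf isogonal_fin_iff)
qed

text \<open>Both pairs of lines at the vertex have a direction product that is a real multiple of
  \<open>u * w\<close>. For the sides this follows from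
  \<open>(b - a) * (d - a) = u * (a + c - b - d)\<close>.\<close>

lemma conjugates_isogonal_at_vertex:
  assumes "(a - p) * (c - p) = m" "(b - p) * (d - p) = m" "(a + c - b - d) / w \<in> \<real>"
    and dist: "a \<noteq> b" "a \<noteq> c" "a \<noteq> d" and a: "fin_pt a \<in> curve F" and "conj_pt Z Z'"
  shows "isogonal (fin_pt a) (line_join F (fin_pt a) Z) (line_join F (fin_pt a) Z')
           (line_join F (fin_pt a) (fin_pt b)) (line_join F (fin_pt a) (fin_pt d))"
proof -
  define u where "u = a - p"
  have a_eq: "a = p + u" by (simp add: u_def)
  have "u \<noteq> 0" using assms(1) m_nz by (auto simp: u_def)
  then have u: "on_curve u" using a fin_in_curve_iff[of u] by (simp add: u_def)
  have mu: "m / u = c - p" using assms(1) \<open>u \<noteq> 0\<close> by (auto simp: u_def)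
  \<comment> \<open>The conjugate of \<open>a\<close> is the opposite vertex \<open>c\<close>, so a
    vertex is never self-conjugate.\<close>
  have "\<not> (Z = fin_pt (p + u) \<and> Z' = fin_pt (p + u))"
    using assms(8) mu dist(2) unfolding conj_pt_def u_def by auto
  with line_joins_to_conjugates[OF u assms(8)]
  obtain d1 d2 where d: "d1 \<noteq> 0" "d2 \<noteq> 0" "line_join F (fin_pt a) Z = affine_line a d1"
    "line_join F (fin_pt a) Z' = affine_line a d2" "d1 * d2 / (u * w) \<in> \<real>"
    unfolding a_eq by metis
  have "(b - a) * (d - a) = (b - p) * (d - p) - (a - p) * (c - p) + (a - p) * (a + c - b - d)"
    by (simp add: algebra_simps)
  then have bd: "(b - a) * (d - a) = u * (a + c - b - d)" by (simp add: assms(1,2) u_def)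
  then have "(b - a) * (d - a) / (u * w) \<in> \<real>" using \<open>u \<noteq> 0\<close> assms(3) by simp
  then have "(u * w) / ((b - a) * (d - a)) \<in> \<real>" by (rule Reals_divide_swap)
  with d(5) have "d1 * d2 / ((b - a) * (d - a)) \<in> \<real>"
    by (rule Reals_divide_trans) (use \<open>u \<noteq> 0\<close> w_nz in simp)
  then show ?thesis
    using d dist by (simp add: line_join_fin_fin isogonal_fin_iff)
qed

text \<open>\<open>isogonal_cubic_of_normal_form\<close> brings any quadrilateral of the cubic to
  the same data, and the vertex lemma applies at each corner. Exchanging the two pairs of opposite
  vertices only changes a sign.\<close>

lemma conj_pt_isogonal_conjugates:
  assumes conj: "conj_pt Z Z'"
  shows "isogonal_conjugates F Z Z'"
  unfolding isogonal_conjugates_def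
proof (intro conjI allI impI)
  fix a b c d assume abcd: "isogonal_cubic_of F a b c d"
  note nf = isogonal_cubic_of_normal_form[OF abcd w_nz ev_F]
  have dist: "distinct [a, b, c, d]" using abcd by (simp add: isogonal_cubic_of_def)
  have in_curve: "fin_pt v \<in> curve F" if "v \<in> {a, b, c, d}" for v
  proof -
    have "complex_of_real (ev F (v, 1)) = 0"
      using abcd that unfolding isogonal_cubic_of_def by (elim conjE exE insertE) simp_all
    then have "ev F (v, 1) = 0" by simp
    then show ?thesis unfolding fin_pt_def by (subst span_in_curve_iff) (simp_all add: zero_prod_def)
  qed
  have neg: "(b + d - a - c) / w \<in> \<real>"
  proof -
    have "b + d - a - c = - (a + c - b - d)" by simp
    then show ?thesis using nf(3) by (metis Reals_minus minus_divide_left)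
  qed
  have perm: "(c + a - b - d) / w \<in> \<real>" "(d + b - c - a) / w \<in> \<real>"
    using nf(3) neg by (simp_all add: algebra_simps)
  have "(c - p) * (a - p) = m" "(d - p) * (b - p) = m" using nf(1,2) by (simp_all add: mult.commute)
  then show "isogonal_conjugates_in F a b c d Z Z'"
    unfolding isogonal_conjugates_in_def Let_def using dist nf neg perm conj
    by (intro conjI conjugates_isogonal_at_vertex[of a c b d] conjugates_isogonal_at_vertex[of b d a c]
        conjugates_isogonal_at_vertex[of c a b d] conjugates_isogonal_at_vertex[of d b c a] in_curve) auto
qed (use conj conj_pt_in_curve in auto)

section \<open>Chords cannot be isogonal to themselves at both ends\<close>

lemma not_both_degenerate: "\<lbrakk>k = 0; m / w\<^sup>2 \<in> \<real>\<rbrakk> \<Longrightarrow> False"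
  using nondegenerate w_nz by (simp add: divide_in_Reals_iff)

text \<open>On the line through the spiral center parallel to \<open>w\<close> the equation of the
  cubic becomes linear in \<open>s\<close>. Hence two such points force
  \<open>k = 0\<close>.\<close>

lemma on_curve_on_axis:
  assumes "on_curve (of_real s * w)"
  shows "s \<noteq> 0" "Im (m / w\<^sup>2) * (norm w)\<^sup>2 = k * s"
proof -
  show s: "s \<noteq> 0" using assms by (auto simp: on_curve_def)
  have "cnj w * (of_real s * w + m / (of_real s * w)) =
      of_real (s * (norm w)\<^sup>2) + of_real ((norm w)\<^sup>2 / s) * (m / w\<^sup>2)"
    unfolding of_real_mult of_real_divide complex_norm_square using s w_nz
    by (simp add: field_simps power2_eq_square)
  then have "k = Im (of_real (s * (norm w)\<^sup>2) + of_real ((norm w)\<^sup>2 / s) * (m / w\<^sup>2))"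
    using assms by (simp only: on_curve_def)
  then have "k = (norm w)\<^sup>2 / s * Im (m / w\<^sup>2)"
    by (simp only: plus_complex.sel Im_of_real_mult Im_complex_of_real add_0)
  then show "Im (m / w\<^sup>2) * (norm w)\<^sup>2 = k * s" using s by simp
qed

lemma on_axis_k_nz:
  assumes "on_curve x" "x / w \<in> \<real>" "k = 0"
  shows False
proof -
  obtain s where s: "x = of_real s * w" using assms(2) w_nz by (auto simp: div_Reals_iff)
  have "Im (m / w\<^sup>2) * (norm w)\<^sup>2 = k * s"
    using assms(1) s on_curve_on_axis(2) by blast
  then have "m / w\<^sup>2 \<in> \<real>" using assms(3) w_nz by (simp add: complex_is_Real_iff)
  with assms(3) show False by (rule not_both_degenerate)
qed

text \<open>The two conditions make \<open>x / y\<close> and then \<open>y / w\<close> real. Both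
  points lie on the axis through the spiral center, so \<open>k = 0\<close>, which
  \<open>on_axis_k_nz\<close> excludes.\<close>

lemma not_self_isogonal_fin_fin:
  assumes x: "on_curve x" and y: "on_curve y" and "x \<noteq> y"
    and xw: "(y - x)\<^sup>2 / (x * w) \<in> \<real>" and yw: "(y - x)\<^sup>2 / (y * w) \<in> \<real>"
  shows False
proof -
  have nz: "x \<noteq> 0" "y \<noteq> 0" using x y by (auto simp: on_curve_def)
  have "(x * w) / (y * w) \<in> \<real>"
    using Reals_divide_trans[OF Reals_divide_swap[OF xw] yw] \<open>x \<noteq> y\<close> by simp
  then have xy: "x / y \<in> \<real>" using w_nz by simp
  \<comment> \<open>Multiplying \<open>yw\<close> by the square of this real number cancels
    \<open>(y - x)^2\<close> and leaves \<open>y / w\<close>.\<close>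
  then have "(y / (y - x)) \<in> \<real>"
    using Reals_inverse[OF Reals_diff[OF Reals_1 xy]] nz \<open>x \<noteq> y\<close> by (simp add: field_simps)
  then have "(y / (y - x))\<^sup>2 * ((y - x)\<^sup>2 / (y * w)) \<in> \<real>" using yw by (intro Reals_mult Reals_power)
  also have "(y / (y - x))\<^sup>2 * ((y - x)\<^sup>2 / (y * w)) = y / w"
    using nz \<open>x \<noteq> y\<close> by (simp add: power_divide) (simp add: power2_eq_square)
  finally have yw': "y / w \<in> \<real>" .
  with xy nz have "x / w \<in> \<real>" by (metis Reals_divide_trans)
  then obtain s where s: "x = of_real s * w" using w_nz by (auto simp: div_Reals_iff)
  obtain t where t: "y = of_real t * w" using w_nz yw' by (auto simp: div_Reals_iff)
  have "k * s = k * t"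
    using on_curve_on_axis(2)[OF x[unfolded s]] on_curve_on_axis(2)[OF y[unfolded t]] by linarith
  then have "k = 0" using \<open>x \<noteq> y\<close> s t by auto
  with y yw' show False using on_axis_k_nz by blast
qed

text \<open>With \<open>y\<close> a real multiple of \<open>w\<close>, the first quotient says that
  \<open>m / w^2\<close> is real; then \<open>on_curve_on_axis\<close> gives
  \<open>k = 0\<close>.\<close>

lemma not_self_isogonal_P_fin:
  assumes y: "on_curve y" and "y\<^sup>2 / (m * cnj w * w) \<in> \<real>" "y / w \<in> \<real>"
  shows False
proof -
  have nz: "y \<noteq> 0" using y by (auto simp: on_curve_def)
  obtain s where s: "y = of_real s * w" using assms(3) w_nz by (auto simp: div_Reals_iff)
  have "s \<noteq> 0" using nz s by auto
  have "(m * cnj w * w) / y\<^sup>2 \<in> \<real>" using assms(2) by (rule Reals_divide_swap)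
  then have "(m * cnj w * w) / y\<^sup>2 * of_real (s\<^sup>2 / (norm w)\<^sup>2) \<in> \<real>" by (intro Reals_mult Reals_of_real)
  also have "(m * cnj w * w) / y\<^sup>2 * of_real (s\<^sup>2 / (norm w)\<^sup>2) = m / w\<^sup>2"
    unfolding of_real_divide complex_norm_square s using \<open>s \<noteq> 0\<close> w_nz by (simp add: field_simps power2_eq_square)
  finally have mw: "m / w\<^sup>2 \<in> \<real>" .
  then have "k * s = 0"
    using on_curve_on_axis(2)[of s] y by (simp add: s complex_is_Real_iff)
  with \<open>s \<noteq> 0\<close> mw show False using not_both_degenerate by auto
qed

abbreviation self_isogonal :: "subsp \<Rightarrow> subsp \<Rightarrow> bool" where
  "self_isogonal X l \<equiv> isogonal X l l (line_join F X (fin_pt p)) (line_join F X (inf_pt w))"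

lemma self_isogonal_fin: "\<lbrakk>x \<noteq> 0; d \<noteq> 0\<rbrakk> \<Longrightarrow>
    self_isogonal (fin_pt (p + x)) (affine_line (p + x) d) \<longleftrightarrow> d\<^sup>2 / (x * w) \<in> \<real>"
  using w_nz by (simp add: line_join_fin_P line_join_fin_inf isogonal_fin_iff power2_eq_square)

lemma self_isogonal_P: "d \<noteq> 0 \<Longrightarrow>
    self_isogonal (fin_pt p) (affine_line p d) \<longleftrightarrow> d\<^sup>2 / (m * cnj w * w) \<in> \<real>"
  using w_nz m_nz by (simp add: line_join_P_P line_join_fin_inf isogonal_fin_iff power2_eq_square)

lemma self_isogonal_Pinf:
  "self_isogonal (inf_pt w) (affine_line (p + x) w) \<longleftrightarrow> 2 * Im (cnj w * x) = k"
proof -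
  have "self_isogonal (inf_pt w) (affine_line (p + x) w) \<longleftrightarrow> (2 * x - \<i> * of_real k / cnj w) / w \<in> \<real>"
    using w_nz by (simp add: line_join_Pinf_Pinf line_join_inf_fin isogonal_inf_iff algebra_simps)
  also have "\<dots> \<longleftrightarrow> Im (cnj w * (2 * x - \<i> * of_real k / cnj w)) = 0"
    unfolding over_w_in_Reals_iff ..
  also have "\<dots> \<longleftrightarrow> Im (cnj w * (2 * x)) - k = 0"
    unfolding right_diff_distrib minus_complex.sel Im_cnj_w_k ..
  also have "\<dots> \<longleftrightarrow> 2 * Im (cnj w * x) = k" by (simp add: algebra_simps)
  finally show ?thesis .
qed

text \<open>In each combination of the spiral center, the point at infinity and other points, the
  two conditions lead to the excluded case \<open>k = 0\<close> with \<open>m / w^2\<close>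
  real.\<close>

lemma not_both_self_isogonal:
  assumes "X \<in> curve F" "Y \<in> curve F" "X \<noteq> Y"
    "self_isogonal X (line_join F X Y)" "self_isogonal Y (line_join F X Y)"
  shows False
proof -
  have fin_fin: False if "on_curve x" "on_curve y" "X = fin_pt (p + x)" "Y = fin_pt (p + y)" for x y
  proof -
    have nz: "x \<noteq> 0" "y \<noteq> 0" "x \<noteq> y" using that assms(3) by (auto simp: on_curve_def)
    have "line_join F X Y = affine_line (p + x) (y - x)" "line_join F X Y = affine_line (p + y) (x - y)"
      using that nz assms(3) line_join_commute[of X Y F] by (simp_all add: line_join_fin_fin)
    then have "(y - x)\<^sup>2 / (x * w) \<in> \<real>" "(x - y)\<^sup>2 / (y * w) \<in> \<real>"
      using assms(4,5) that nz self_isogonal_fin[of x "y - x"] self_isogonal_fin[of y "x - y"] by auto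
    with not_self_isogonal_fin_fin[OF that(1,2) nz(3)] show False by (simp add: power2_commute[of x y])
  qed
  \<comment> \<open>This and the next two facts avoid \<open>X\<close> and \<open>Y\<close> so as to
    serve both orders of the two points.\<close>
  have P_fin: False if "on_curve y" "self_isogonal (fin_pt p) (line_join F (fin_pt p) (fin_pt (p + y)))"
    "self_isogonal (fin_pt (p + y)) (line_join F (fin_pt p) (fin_pt (p + y)))" for y
  proof -
    have y: "y \<noteq> 0" using that(1) by (simp add: on_curve_def)
    have "line_join F (fin_pt p) (fin_pt (p + y)) = affine_line p y"
      "line_join F (fin_pt p) (fin_pt (p + y)) = affine_line (p + y) (- y)"
      using y line_join_commute[of "fin_pt p" "fin_pt (p + y)" F] by (simp_all add: line_join_fin_fin)
    then have "y\<^sup>2 / (m * cnj w * w) \<in> \<real>" "(- y)\<^sup>2 / (y * w) \<in> \<real>"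
      using that(2,3) y self_isogonal_P[of y] self_isogonal_fin[of y "- y"] by auto
    then show False using not_self_isogonal_P_fin[OF that(1)] y by (simp add: power2_eq_square)
  qed
  have Pinf_fin: False if "on_curve y" "self_isogonal (inf_pt w) (line_join F (inf_pt w) (fin_pt (p + y)))"
    "self_isogonal (fin_pt (p + y)) (line_join F (inf_pt w) (fin_pt (p + y)))" for y
  proof -
    have y: "y \<noteq> 0" using that(1) by (simp add: on_curve_def)
    have "2 * Im (cnj w * y) = k" "w\<^sup>2 / (y * w) \<in> \<real>"
      using that(2,3) y w_nz self_isogonal_Pinf[of y] self_isogonal_fin[of y w] by (simp_all add: line_join_inf_fin)
    moreover from this have yw: "y / w \<in> \<real>"
      using w_nz Reals_divide_swap[of w y] by (simp add: power2_eq_square)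
    then have "Im (cnj w * y) = 0" unfolding over_w_in_Reals_iff .
    ultimately have "k = 0" by simp
    with yw that(1) show False using on_axis_k_nz by blast
  qed
  have P_Pinf: False if "self_isogonal (fin_pt p) (line_join F (fin_pt p) (inf_pt w))"
    "self_isogonal (inf_pt w) (line_join F (fin_pt p) (inf_pt w))"
  proof -
    have "w\<^sup>2 / (m * cnj w * w) \<in> \<real>" "k = 0"
      using that w_nz self_isogonal_P[of w] self_isogonal_Pinf[of 0] by (simp_all add: line_join_fin_inf)
    then have "(m * cnj w * w) / w\<^sup>2 * of_real (1 / (norm w)\<^sup>2) \<in> \<real>"
      by (intro Reals_mult Reals_of_real) (rule Reals_divide_swap)
    also have "(m * cnj w * w) / w\<^sup>2 * of_real (1 / (norm w)\<^sup>2) = m / w\<^sup>2"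
      unfolding of_real_divide complex_norm_square using w_nz by (simp add: field_simps)
    finally show False using not_both_degenerate \<open>k = 0\<close> by blast
  qed
  have comm: "line_join F X Y = line_join F Y X" using assms(3) by (rule line_join_commute)
  show False
  proof (cases rule: curve_cases[OF assms(1)])
    case X: 1
    show ?thesis
    proof (cases rule: curve_cases[OF assms(2)])
      case 1
      with X assms(3) show ?thesis by simp
    next
      case 2
      show ?thesis using P_Pinf assms(4,5) unfolding X 2 by blast
    next
      case (3 y)
      show ?thesis using P_fin[OF 3(1)] assms(4,5) unfolding X 3(2) by blast
    qed
  next
    case X: 2
    show ?thesis
    proof (cases rule: curve_cases[OF assms(2)])
      case 1
      show ?thesis using P_Pinf assms(4,5) unfolding comm unfolding X 1 by blast
    next
      case 2
      with X assms(3) show ?thesis by simp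
    next
      case (3 y)
      show ?thesis using Pinf_fin[OF 3(1)] assms(4,5) unfolding X 3(2) by blast
    qed
  next
    case X: (3 x)
    show ?thesis
    proof (cases rule: curve_cases[OF assms(2)])
      case 1
      show ?thesis using P_fin[OF X(1)] assms(4,5) unfolding comm unfolding X(2) 1 by blast
    next
      case 2
      show ?thesis using Pinf_fin[OF X(1)] assms(4,5) unfolding comm unfolding X(2) 2 by blast
    next
      case (3 y)
      show ?thesis using fin_fin X 3 by blast
    qed
  qed
qed

section \<open>Third intersections and the final configuration\<close>

text \<open>A line in the curve would be parallel to \<open>w\<close>. The form restricted to it is
  quadratic in the parameter, and its vanishing leads back to the excluded degenerate case. Thus the
  binary cubic on a chord is nonzero.\<close>

lemma line_not_in_curve:
  assumes "X \<in> curve F" "Y \<in> curve F" "X \<noteq> Y"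
  shows "\<exists>v\<in>span (X \<union> Y). ev F v \<noteq> 0"
proof (rule ccontr)
  assume "\<not> ?thesis"
  then have zero: "ev F v = 0" if "v \<in> span (X \<union> Y)" for v using that by blast
  obtain Y' where "conj_pt Y Y'" using conj_pt_exists assms(2) by blast
  \<comment> \<open>Being a member of an isogonal pair, the chord is not the line at
    infinity.\<close>
  then have "line_join F X Y \<in> affine_lines_through X"
    using isogonalD(1)[OF conjugate_lines_isogonal[OF assms(1)]] assms(3) by metis
  then obtain z e where e: "e \<noteq> 0" "span (X \<union> Y) = affine_line z e"
    using assms(3) by (auto simp: affine_lines_through_def line_join_def)
  define u where "u = z - p"
  have "ev F (e, 0) = 0" using e by (intro zero) (simp add: mem_affine_line)
  then have "Im (cnj w * e) = 0" using e(1) by (simp add: ev_F iso_form_def)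
  then have "e / w \<in> \<real>" unfolding over_w_in_Reals_iff .
  then have we: "w / e \<in> \<real>" by (rule Reals_divide_swap)
  have "ev F (z + of_real s * w, 1) = 0" for s
    using e Reals_mult[OF Reals_of_real we, of s] by (intro zero) (simp add: mem_affine_line)
  then have s: "iso_form w m k (u + of_real s * w) 1 = 0" for s
    by (simp add: ev_F u_def algebra_simps)
  define h where "h = Im (cnj w * u)"
  have expand: "(h - k) * ((norm u)\<^sup>2 + 2 * s * Re (cnj w * u) + s\<^sup>2 * (norm w)\<^sup>2)
      + Im (cnj w * m * cnj u) + s * Im ((cnj w)\<^sup>2 * m) = 0" for s
    using s[of s] unfolding iso_form_def h_def cmod_power2
    by (simp add: algebra_simps power2_eq_square)
  \<comment> \<open>A second difference over the parameters 1, 0 and -1 isolates the quadratic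
    coefficient.\<close>
  have "2 * ((h - k) * C) = 0"
    if "\<And>s. (h - k) * (A + 2 * s * B + s\<^sup>2 * C) + D + s * E = 0" for A B C D E
  proof -
    have "2 * ((h - k) * C) = ((h - k) * (A + 2 * 1 * B + 1\<^sup>2 * C) + D + 1 * E)
      + ((h - k) * (A + 2 * (- 1) * B + (- 1)\<^sup>2 * C) + D + (- 1) * E)
      - 2 * ((h - k) * (A + 2 * 0 * B + 0\<^sup>2 * C) + D + 0 * E)"
      by (simp add: algebra_simps)
    then show ?thesis by (simp only: that)
  qed
  from this[OF expand] have "(h - k) * (norm w)\<^sup>2 = 0" by simp
  then have "h = k" using w_nz by simp
  with expand[of 0] expand[of 1] have mu: "Im (cnj w * m * cnj u) = 0" and wm: "Im ((cnj w)\<^sup>2 * m) = 0"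
    by simp_all
  have wm_nz: "cnj w * m \<noteq> 0" using w_nz m_nz by simp
  have "Im (cnj (cnj w * m) * u) = - Im (cnj w * m * cnj u)" by (simp add: algebra_simps)
  then have "Im (cnj (cnj w * m) * u) = 0" using mu by linarith
  then have "u / (cnj w * m) \<in> \<real>" unfolding divide_in_Reals_iff[OF wm_nz] .
  moreover have "Im (cnj w * (cnj w * m)) = 0" using wm by (simp only: power2_eq_square mult.assoc)
  then have "cnj w * m / w \<in> \<real>" unfolding over_w_in_Reals_iff .
  \<comment> \<open>Both \<open>u\<close> and \<open>w\<close> are parallel to
    \<open>cnj w * m\<close>, so the line passes through the spiral center.\<close>
  ultimately have "u / w \<in> \<real>" using wm_nz by (rule Reals_divide_trans)
  then have "h = 0" unfolding over_w_in_Reals_iff h_def .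
  with \<open>h = k\<close> wm nondegenerate show False by simp
qed

lemma third_intersection_props:
  assumes "X \<in> curve F" "Y \<in> curve F" "X \<noteq> Y"
  defines "Z \<equiv> third_intersection F X Y"
  shows "Z \<in> curve F" "Z \<subseteq> span (X \<union> Y)"
    "Z = X \<Longrightarrow> Y \<subseteq> tangent F X" "Z = Y \<Longrightarrow> X \<subseteq> tangent F Y"
proof -
  obtain x y where x: "x \<noteq> 0" "X = span {x}" and y: "y \<noteq> 0" "Y = span {y}"
    using assms(1,2) by (auto simp: curve_def rp2_def)
  \<comment> \<open>With \<open>x\<close> and \<open>y\<close> on the cubic only the two mixed terms
    of \<open>ev_combination\<close> remain. Hence \<open>\<beta> = 0\<close>, meaning
    \<open>Z = X\<close>, is tangency at \<open>X\<close>; likewise \<open>\<alpha> = 0\<close> is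
    tangency at \<open>Y\<close>.\<close>
  define \<beta> where "\<beta> = polar_vec x y"
  define \<alpha> where "\<alpha> = - polar_vec y x"
  have ev0: "ev F x = 0" "ev F y = 0" using assms(1,2) x y by (simp_all add: span_in_curve_iff)
  have cubic: "ev F (s *\<^sub>R x + t *\<^sub>R y) = s * t * (\<beta> * s - \<alpha> * t)" for s t
    unfolding ev_combination ev0 \<alpha>_def \<beta>_def by (simp add: algebra_simps power2_eq_square)
  have XY: "span (X \<union> Y) = span {x, y}" unfolding x y span_Un_span by (simp add: insert_commute)
  have indep: "s = 0 \<and> t = 0" if "s *\<^sub>R x + t *\<^sub>R y = 0" for s t
  proof (cases "t = 0")
    case True
    then show ?thesis using that x by simp
  next
    case False
    from that have "t *\<^sub>R y = (- s) *\<^sub>R x" by (simp add: eq_neg_iff_add_eq_0 add.commute)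
    then have "y = (- s / t) *\<^sub>R x" using False by (metis (no_types) divideR_right divide_inverse_commute scaleR_scaleR)
    then have "y \<in> X" unfolding x by (metis span_scale span_base singletonI)
    then have "Y \<subseteq> X" unfolding x y by (simp add: span_minimal)
    then have "Y = X"
      using assms(1,2) by (intro rp2_subset_imp_eq) (auto simp: curve_def subspace_rp2 dim_rp2)
    with assms(3) show ?thesis by simp
  qed
  have nz: "(\<alpha>, \<beta>) \<noteq> (0, 0)"
  proof
    assume "(\<alpha>, \<beta>) = (0, 0)"
    then have *: "ev F (s *\<^sub>R x + t *\<^sub>R y) = 0" for s t using cubic by simp
    obtain v where v: "v \<in> span {x, y}" "ev F v \<noteq> 0"
      using line_not_in_curve[OF assms(1-3)] unfolding XY by blast
    then obtain s t where "v = s *\<^sub>R x + t *\<^sub>R y"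
      by (auto simp: span_insert span_singleton) (metis add.commute diff_eq_eq)
    with * v(2) show False by simp
  qed
  define z where "z = \<alpha> *\<^sub>R x + \<beta> *\<^sub>R y"
  have "z \<noteq> 0" using indep nz by (auto simp: z_def)
  have Z: "Z = span {z}"
    unfolding Z_def third_intersection_def
  proof (rule the_equality)
    show "\<exists>x y \<alpha> \<beta>. X = span {x} \<and> Y = span {y} \<and> (\<alpha>, \<beta>) \<noteq> (0, 0) \<and>
        span {z} = span {\<alpha> *\<^sub>R x + \<beta> *\<^sub>R y} \<and>
        (\<forall>s t. ev F (s *\<^sub>R x + t *\<^sub>R y) = s * t * (\<beta> * s - \<alpha> * t))"
      using x y nz cubic z_def by blast
  next
    fix Q assume "\<exists>x y \<alpha> \<beta>. X = span {x} \<and> Y = span {y} \<and> (\<alpha>, \<beta>) \<noteq> (0, 0) \<and>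
        Q = span {\<alpha> *\<^sub>R x + \<beta> *\<^sub>R y} \<and>
        (\<forall>s t. ev F (s *\<^sub>R x + t *\<^sub>R y) = s * t * (\<beta> * s - \<alpha> * t))"
    then obtain x' y' \<alpha>' \<beta>' where Q: "X = span {x'}" "Y = span {y'}" "Q = span {\<alpha>' *\<^sub>R x' + \<beta>' *\<^sub>R y'}"
      and cubic': "\<And>s t. ev F (s *\<^sub>R x' + t *\<^sub>R y') = s * t * (\<beta>' * s - \<alpha>' * t)"
      by blast
    have "x' \<in> span {x}" "y' \<in> span {y}" using Q x y by (auto intro: span_base)
    then obtain l n where ln: "x' = l *\<^sub>R x" "y' = n *\<^sub>R y" by (auto simp: span_singleton)
    have "l \<noteq> 0" "n \<noteq> 0" using Q(1,2) x y ln span_base[of x "{x}"] span_base[of y "{y}"] by auto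
    have "s * t * (\<beta>' * s - \<alpha>' * t) = s * l * (t * n) * (\<beta> * (s * l) - \<alpha> * (t * n))" for s t
      using cubic'[of s t] cubic[of "s * l" "t * n"] by (simp only: ln scaleR_scaleR)
    \<comment> \<open>Other representatives of \<open>X\<close> and \<open>Y\<close> rescale the
      root vector by \<open>l^2 * n^2\<close> only, so the point is well defined.\<close>
    from this[of 1 1] this[of 1 "-1"] have "\<beta>' = l\<^sup>2 * n * \<beta>" "\<alpha>' = l * n\<^sup>2 * \<alpha>"
      by (simp_all add: algebra_simps power2_eq_square)
    then have eq: "\<alpha>' *\<^sub>R x' + \<beta>' *\<^sub>R y' = (l\<^sup>2 * n\<^sup>2) *\<^sub>R z"
      unfolding z_def ln by (simp add: scaleR_add_right power2_eq_square mult_ac)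
    have "Q \<subseteq> span {z}" unfolding Q eq by (intro span_minimal) (auto intro: span_scale span_base)
    moreover have "(l\<^sup>2 * n\<^sup>2) *\<^sub>R z \<noteq> 0"
      using \<open>l \<noteq> 0\<close> \<open>n \<noteq> 0\<close> \<open>z \<noteq> 0\<close> by (metis scaleR_eq_0_iff mult_eq_0_iff power_eq_0_iff)
    then have "Q \<in> rp2" unfolding Q eq rp2_def by blast
    ultimately show "Q = span {z}"
      using \<open>z \<noteq> 0\<close> by (intro rp2_subset_imp_eq) (auto simp: dim_singleton)
  qed
  have "ev F z = 0" unfolding z_def cubic by simp
  then show "Z \<in> curve F" unfolding Z using \<open>z \<noteq> 0\<close> by (simp add: span_in_curve_iff)
  show "Z \<subseteq> span (X \<union> Y)" unfolding Z XY z_def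
    by (intro span_minimal) (auto intro!: span_add span_scale intro: span_base)
  have zZ: "z \<in> Z" unfolding Z by (simp add: span_base)
  have subspace_tangent: "span {v'} \<subseteq> tangent F (span {v})" if "ev F v = 0" "polar_vec v v' = 0" for v v'
  proof
    fix u assume "u \<in> span {v'}"
    then obtain c where c: "u = c *\<^sub>R v'" by (auto simp: span_singleton)
    have "polar_vec v (c *\<^sub>R v') = c * polar_vec v v'"
      unfolding polar_vec_def polar_def by (simp add: algebra_simps)
    with that show "u \<in> tangent F (span {v})" by (simp add: c mem_tangent_iff)
  qed
  show "Y \<subseteq> tangent F X" if "Z = X"
  proof -
    have "z \<in> span {x}" using zZ unfolding that x(2) .
    then obtain c where "z = c *\<^sub>R x" by (auto simp: span_singleton)
    then have "(\<alpha> - c) *\<^sub>R x + \<beta> *\<^sub>R y = 0" by (simp add: z_def algebra_simps)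
    then have "\<beta> = 0" using indep by blast
    then show ?thesis using subspace_tangent ev0 x y by (simp add: \<beta>_def)
  qed
  show "X \<subseteq> tangent F Y" if "Z = Y"
  proof -
    have "z \<in> span {y}" using zZ unfolding that y(2) .
    then obtain c where "z = c *\<^sub>R y" by (auto simp: span_singleton)
    then have "\<alpha> *\<^sub>R x + (\<beta> - c) *\<^sub>R y = 0" by (simp add: z_def algebra_simps)
    then have "\<alpha> = 0" using indep by blast
    then show ?thesis using subspace_tangent ev0 x y by (simp add: \<alpha>_def)
  qed
qed

text \<open>The line \<open>XZ\<close> equals \<open>XY\<close>, by tangency if
  \<open>Z = X\<close>, so uniqueness of the isogonal line identifies \<open>XZ'\<close> with
  \<open>XY'\<close>. If \<open>Z' = X\<close>, it suffices that \<open>XY'\<close> passes through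
  \<open>X\<close>.\<close>

lemma conjugate_on_isogonal_line:
  assumes "X \<in> curve F" "Y \<in> curve F" "X \<noteq> Y" "conj_pt Y Y'" "conj_pt Z Z'"
    and "Z \<subseteq> span (X \<union> Y)" "Z = X \<Longrightarrow> Y \<subseteq> tangent F X"
  shows "Z' \<subseteq> line_join F X Y'"
proof (cases "Z' = X")
  case True
  then show ?thesis
    using affine_lines_throughD(1) isogonalD(2) conjugate_lines_isogonal[OF assms(1,4)] assms(3) by metis
next
  case False
  then have iso: "isogonal X (line_join F X Z) (line_join F X Z')
           (line_join F X (fin_pt p)) (line_join F X (inf_pt w))"
    by (intro conjugate_lines_isogonal assms(1,5)) auto
  have iso_Y: "isogonal X (line_join F X Y) (line_join F X Y')
           (line_join F X (fin_pt p)) (line_join F X (inf_pt w))"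
    using assms by (intro conjugate_lines_isogonal) auto
  note rp2 = assms(1,2)[THEN curve_subset_rp2] conj_pt_in_curve[OF assms(5), THEN curve_subset_rp2]
  note line = affine_lines_throughD[OF isogonalD(1)[OF iso]] affine_lines_throughD[OF isogonalD(1)[OF iso_Y]]
  have "line_join F X Z = line_join F X Y"
  proof (cases "Z = X")
    case True
    have "span (X \<union> Y) = line_join F X Z"
      using True assms(3,7) line rp2 by (intro span_Un_eq_line) (auto simp: line_join_def)
    then show ?thesis using assms(3) by (simp add: line_join_def)
  next
    case False
    have "span (X \<union> Z) = line_join F X Y"
      using False assms(3,6) line rp2 by (intro span_Un_eq_line) (auto simp: line_join_def)
    then show ?thesis using False by (simp add: line_join_def)
  qed
  with iso iso_Y have "line_join F X Z' = line_join F X Y'" by (metis isogonal_unique)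
  moreover have "Z' \<subseteq> line_join F X Z'"
    using False span_superset[of "X \<union> Z'"] by (auto simp: line_join_def)
  ultimately show ?thesis by simp
qed

text \<open>The two isogonal lines are concretely \<open>XY'\<close> and \<open>YX'\<close>, joins
  with the conjugates of the opposite points; both contain the conjugate of the third
  intersection.\<close>

lemma third_intersection_conjugate:
  assumes X: "X \<in> curve F" and Y: "Y \<in> curve F" and "X \<noteq> Y"
  defines "lX \<equiv> isogonal_line X (line_join F X Y) (line_join F X (fin_pt p)) (line_join F X (inf_pt w))"
    and "lY \<equiv> isogonal_line Y (line_join F X Y) (line_join F Y (fin_pt p)) (line_join F Y (inf_pt w))"
  shows "conj_pt (lX \<inter> lY) (third_intersection F X Y)"
proof -
  define Z where "Z = third_intersection F X Y"
  note props = third_intersection_props[OF assms(1-3), folded Z_def]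
  obtain X' Y' Z' where conj: "conj_pt X X'" "conj_pt Y Y'" "conj_pt Z Z'"
    using X Y props(1) conj_pt_exists by metis
  have comm: "line_join F X Y = line_join F Y X" using assms(3) by (rule line_join_commute)
  have iso_X: "isogonal X (line_join F X Y) (line_join F X Y') (line_join F X (fin_pt p)) (line_join F X (inf_pt w))"
    using assms(1-3) conj by (intro conjugate_lines_isogonal) auto
  then have lX: "lX = line_join F X Y'" unfolding lX_def by (rule isogonal_line_eqI)
  have iso_Y: "isogonal Y (line_join F X Y) (line_join F Y X') (line_join F Y (fin_pt p)) (line_join F Y (inf_pt w))"
    unfolding comm using assms(1-3) conj by (intro conjugate_lines_isogonal) auto
  then have lY: "lY = line_join F Y X'" unfolding lY_def by (rule isogonal_line_eqI)
  have Z'_lX: "Z' \<subseteq> lX"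
    unfolding lX using conj props assms(1-3) by (intro conjugate_on_isogonal_line[of X Y Y' Z]) auto
  have Z'_lY: "Z' \<subseteq> lY"
    unfolding lY using conj props assms(1-3)
    by (intro conjugate_on_isogonal_line[of Y X X' Z]) (auto simp: Un_commute)
  note line = affine_lines_throughD[OF isogonalD(2)[OF iso_X], folded lX]
    affine_lines_throughD[OF isogonalD(2)[OF iso_Y], folded lY]
  have "lX \<noteq> lY"
  proof
    assume "lX = lY"
    then have "span (X \<union> Y) = lX"
      using X Y \<open>X \<noteq> Y\<close> line by (intro span_Un_eq_line) (auto simp: curve_subset_rp2)
    then have "line_join F X Y = lX" using \<open>X \<noteq> Y\<close> by (simp add: line_join_def)
    then show False
      using iso_X iso_Y not_both_self_isogonal[OF assms(1-3)] \<open>lX = lY\<close> lX lY by metis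
  qed
  then have "lX \<inter> lY = Z'"
    using line Z'_lX Z'_lY conj_pt_in_curve(2)[OF conj(3)]
    by (intro lines_Int_eq_point) (auto simp: curve_subset_rp2)
  with conj_pt_commute[OF conj(3)] show ?thesis by (simp add: Z_def)
qed

end

theorem theorem7p4:
  fixes F :: form and P Pinf X Y :: subsp
  assumes "isogonal_cubic F" and "irreducible F"
    and "spiral_center F P"
    and "Pinf \<in> curve F" and "\<exists>e. e \<noteq> 0 \<and> Pinf = inf_pt e"
    and "X \<in> curve F" and "Y \<in> curve F" and "X \<noteq> Y"
  defines "lX \<equiv> isogonal_line X (line_join F X Y) (line_join F X P) (line_join F X Pinf)"
    and "lY \<equiv> isogonal_line Y (line_join F X Y) (line_join F Y P) (line_join F Y Pinf)"
  shows "isogonal_conjugates F (lX \<inter> lY) (third_intersection F X Y)"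
proof -
  obtain a b c d p where abcd: "isogonal_cubic_of F a b c d" "(a - p) * (c - p) = (b - p) * (d - p)"
    and P: "P = fin_pt p"
    using assms(3) unfolding spiral_center_def by blast
  obtain w m k where wmk: "w \<noteq> 0" "m \<noteq> 0"
    "\<And>x t. ev F (x, t) = iso_form w m k (x - of_real t * p) t"
    using spiral_center_normal_form[OF abcd] by blast
  interpret iso_cubic F p w m k
    by unfold_locales
      (use wmk irreducible_normal_form_nondegenerate[OF assms(2) wmk(1,3)] in auto)
  obtain e where "e \<noteq> 0" "Pinf = inf_pt e" using assms(5) by blast
  \<comment> \<open>The cubic has a single real point at infinity, so the given one is that of the
    normal form.\<close>
  then have "Pinf = inf_pt w" using assms(4) inf_in_curve_iff by simp
  with P show ?thesis
    unfolding lX_def lY_def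
    using conj_pt_isogonal_conjugates[OF third_intersection_conjugate[OF assms(6-8)]] by simp
qed

end
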